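(* Let $G$ be a subgroup of $(M_n(\mathbb{C}),+)$ and assume that $M \mapsto \exp(M)$ is a group homomorphism from $(G,+)$ to $(\mathrm{GL}_n(\mathbb{C}),\times)$. Then $AB = BA$ for all $A, B \in G$.
   Context: $\exp$ denotes the matrix exponential. *)

theory Defs
  imports "HOL-Analysis.Analysis"
begin

primrec matpow :: "complex^'n^'n \<Rightarrow> nat \<Rightarrow> complex^'n^'n" where
  "matpow A 0 = mat 1"
| "matpow A (Suc k) = A ** matpow A k"

definition mexp :: "complex^'n^'n \<Rightarrow> complex^'n^'n" where
  "mexp A = (\<Sum>k. (1 / fact k) *\<^sub>R matpow A k)"

end

theory Submission
  imports Defs "HOL-Computational_Algebra.Fundamental_Theorem_Algebra"
begin

text \<open>
  Write \<open>U = exp A\<close>, \<open>V = exp B\<close> and choose logarithms \<open>a\<close> of \<open>U\<close> and \<open>b\<close> of \<open>V\<close> in the respective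
  bicommutants; then \<open>a\<close> commutes with \<open>A\<close> and \<open>b\<close>, and \<open>b\<close> with \<open>B\<close>. As \<open>A + B\<close>, \<open>A + 2B\<close>, \<open>2A + B\<close> commute
  with their exponentials \<open>UV\<close>, \<open>UV\<^sup>2\<close>, \<open>U\<^sup>2V\<close>, one gets \<open>[b, A] + [a, B] = 0\<close>, so every integer combination
  of \<open>A' = A - a\<close> and \<open>B' = B - b\<close> has exponential \<open>1\<close>, that is, it is diagonalizable with spectrum in
  \<open>2\<pi>i\<int>\<close>.

  Such \<open>A'\<close> and \<open>B'\<close> commute. Up to the factor \<open>2\<pi>i\<close>, the eigenvalues of \<open>B' + kA'\<close> are integers at
  bounded distance from \<open>k\<close> times those of \<open>A'\<close>, so they lie on finitely many lines \<open>\<mu> + t\<lambda>\<close>, and the product of the \<open>B' + tA' - \<mu> - t\<lambda>\<close> vanishes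
  for all integers \<open>t\<close>, hence identically. The resulting eigenprojections are rational functions of \<open>t\<close>
  with rational poles only. First-order perturbation theory excludes a pole wherever the pencil is
  diagonalizable, which includes the rational points and infinity; so the projections
  are constant and diagonalize \<open>A'\<close> and \<open>B'\<close> simultaneously.

  Finally \<open>[A', b] = [a, B']\<close> commutes with \<open>A'\<close>, and \<open>exp A' = 1\<close> forces it to vanish.
\<close>

section \<open>Spectral resolutions\<close>

text \<open>Multiplying the vanishing sum by \<open>x - c j\<close> removes \<open>f j\<close> and
  rescales every other term by a nonzero factor. The operator here is left multiplication by
  \<open>x\<close> on the algebra itself.\<close>

lemma eigenvectors_independent:
  fixes x :: "'a::real_algebra_1" and c :: "'i \<Rightarrow> real"
  assumes "finite S" "inj_on c S" "\<And>i. i \<in> S \<Longrightarrow> x * f i = c i *\<^sub>R f i" "(\<Sum>i\<in>S. f i) = 0" "i \<in> S"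
  shows "f i = 0"
  using assms
proof (induction S arbitrary: f i rule: finite_induct)
  case empty
  then show ?case by simp
next
  case (insert j S)
  have eq: "f j + (\<Sum>i\<in>S. f i) = 0"
    using insert by simp
  have "(\<Sum>i\<in>S. (c i - c j) *\<^sub>R f i) = x * (f j + (\<Sum>i\<in>S. f i)) - c j *\<^sub>R (f j + (\<Sum>i\<in>S. f i))"
    using insert.prems(2)
    by (simp add: algebra_simps sum_distrib_left scaleR_sum_right sum_subtractf)
  then have s0: "(\<Sum>i\<in>S. (c i - c j) *\<^sub>R f i) = 0"
    by (simp add: eq)
  have z: "f k = 0" if "k \<in> S" for k
  proof -
    have "(c k - c j) *\<^sub>R f k = 0"
    proof (rule insert.IH[OF _ _ s0 that])
      show "inj_on c S" using insert.prems(1) by simp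
      show "x * ((c i - c j) *\<^sub>R f i) = c i *\<^sub>R ((c i - c j) *\<^sub>R f i)" if "i \<in> S" for i
        using insert.prems(2)[of i] that by (simp add: mult.commute)
    qed
    moreover have "c k \<noteq> c j"
      using insert.prems(1) insert.hyps(2) that by (auto simp: inj_on_def)
    ultimately show ?thesis by simp
  qed
  then have "f j = 0" using eq by simp
  then show ?case using z insert.prems(4) by blast
qed

text \<open>For matrices this says that \<open>x\<close> is diagonalizable with real spectrum inside
  \<open>S\<close>. Some \<open>E m\<close> may be \<open>0\<close>, so \<open>S\<close> may be
  larger than the spectrum.\<close>

definition spectral_resolution :: "real set \<Rightarrow> (real \<Rightarrow> 'a) \<Rightarrow> 'a::real_algebra_1 \<Rightarrow> bool" where
  "spectral_resolution S E x \<longleftrightarrow>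
     finite S \<and> (\<Sum>m\<in>S. E m) = 1 \<and> (\<forall>m\<in>S. x * E m = m *\<^sub>R E m)"

text \<open>For fixed \<open>m\<close>, the products \<open>E k * E m\<close>, lowered by
  \<open>E m\<close> at \<open>k = m\<close>, are eigenvectors of \<open>x\<close> for distinct
  eigenvalues and sum to \<open>0\<close>.\<close>

lemma spectral_resolution_orthogonal:
  assumes "spectral_resolution S E x" "k \<in> S" "m \<in> S"
  shows "E k * E m = (if k = m then E m else 0)"
proof -
  let ?f = "\<lambda>k. E k * E m - (if k = m then E m else 0)"
  have fin: "finite S" and one: "(\<Sum>m\<in>S. E m) = 1" and eig: "\<And>m. m \<in> S \<Longrightarrow> x * E m = m *\<^sub>R E m"
    using assms(1) by (auto simp: spectral_resolution_def)
  have "?f k = 0"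
  proof (rule eigenvectors_independent[where x = x and c = id, OF fin _ _ _ assms(2)])
    show "inj_on id S" by simp
    show "x * ?f i = id i *\<^sub>R ?f i" if "i \<in> S" for i
      using eig[OF that] by (auto simp: right_diff_distrib mult.assoc[symmetric] scaleR_diff_right)
    show "(\<Sum>k\<in>S. ?f k) = 0"
      using fin assms(3) by (simp add: sum_subtractf sum_distrib_right[symmetric] one)
  qed
  then show ?thesis by simp
qed

lemma spectral_resolution_right:
  assumes "spectral_resolution S E x" "k \<in> S"
  shows "E k * x = k *\<^sub>R E k"
proof -
  have fin: "finite S" and one: "(\<Sum>m\<in>S. E m) = 1" and eig: "\<And>m. m \<in> S \<Longrightarrow> x * E m = m *\<^sub>R E m"
    using assms(1) by (auto simp: spectral_resolution_def)
  have "E k * x = E k * (x * (\<Sum>m\<in>S. E m))" by (simp add: one)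
  also have "\<dots> = (\<Sum>m\<in>S. m *\<^sub>R (E k * E m))"
    by (simp add: sum_distrib_left eig cong: sum.cong)
  also have "\<dots> = (\<Sum>m\<in>S. if k = m then m *\<^sub>R E m else 0)"
    by (rule sum.cong) (auto simp: spectral_resolution_orthogonal[OF assms(1,2)])
  also have "\<dots> = k *\<^sub>R E k"
    using fin assms(2) by simp
  finally show ?thesis .
qed

text \<open>The first-order perturbation argument: compressed to an eigenspace of \<open>y\<close>, the \<open>R j\<close>
  become eigenvectors of the compression of \<open>z\<close> for distinct eigenvalues.\<close>

lemma first_order_independence:
  fixes y z :: "'a::real_algebra_1" and c \<mu> :: "'i \<Rightarrow> real"
  assumes res: "spectral_resolution S E y" and fin: "finite J"
    and inj: "inj_on (\<lambda>j. (c j, \<mu> j)) J"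
    and R: "\<And>j. j \<in> J \<Longrightarrow> y * R j = c j *\<^sub>R R j"
    and W: "\<And>j. j \<in> J \<Longrightarrow> z * R j - \<mu> j *\<^sub>R R j = y * W j - c j *\<^sub>R W j"
    and sum0: "(\<Sum>j\<in>J. R j) = 0" and j: "j \<in> J"
  shows "R j = 0"
proof -
  have finS: "finite S" and one: "(\<Sum>m\<in>S. E m) = 1"
    using res by (auto simp: spectral_resolution_def)
  have ER0: "E m * R i = 0" if "m \<in> S" "i \<in> J" "m \<noteq> c i" for m i
  proof -
    have "m *\<^sub>R (E m * R i) = (E m * y) * R i"
      by (simp add: spectral_resolution_right[OF res that(1)])
    also have "\<dots> = c i *\<^sub>R (E m * R i)"
      by (simp add: mult.assoc R[OF that(2)])
    finally show ?thesis using that(3) by simp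
  qed
  have decomp: "R i = (\<Sum>m\<in>S. E m * R i)" for i
    by (simp add: sum_distrib_right[symmetric] one)
  show ?thesis
  proof (cases "c j \<in> S")
    case False
    then have "(\<Sum>m\<in>S. E m * R j) = 0"
      by (intro sum.neutral) (metis ER0 j)
    then show ?thesis by (rule trans[OF decomp])
  next
    case True
    define K where "K = {i \<in> J. c i = c j}"
    have ER: "E (c j) * R i = R i" if "i \<in> K" for i
    proof -
      have "(\<Sum>m\<in>S. E m * R i) = (\<Sum>m\<in>S. if m = c j then E (c j) * R i else 0)"
        using that by (intro sum.cong refl) (auto simp: K_def ER0)
      also have "\<dots> = E (c j) * R i" using finS True by simp
      finally show ?thesis by (rule trans[OF decomp, symmetric])
    qed
    show ?thesis
    proof (rule eigenvectors_independent[where x = "E (c j) * z" and c = \<mu> and S = K])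
      show "finite K" using fin by (simp add: K_def)
      show "inj_on \<mu> K" using inj by (auto simp: inj_on_def K_def)
      show "j \<in> K" using j by (simp add: K_def)
      \<comment> \<open>Multiplication by \<open>E (c j)\<close> fixes the terms in \<open>K\<close>
        and kills all others, so the vanishing sum over \<open>J\<close> restricts to
        \<open>K\<close>.\<close>
      have "(\<Sum>i\<in>K. R i) = (\<Sum>i\<in>K. E (c j) * R i)" by (simp add: ER)
      also have "\<dots> = (\<Sum>i\<in>J. E (c j) * R i)"
        using fin ER0[OF True] by (intro sum.mono_neutral_left) (auto simp: K_def, metis)
      also have "\<dots> = 0" by (simp add: sum_distrib_left[symmetric] sum0)
      finally show "(\<Sum>i\<in>K. R i) = 0" .
      show "E (c j) * z * R i = \<mu> i *\<^sub>R R i" if i: "i \<in> K" for i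
      proof -
        \<comment> \<open>Since \<open>E (c j) * y = c j *\<^sub>R E (c j)\<close>, compression
          annihilates the term with the unknown \<open>W i\<close>.\<close>
        have "z * R i = \<mu> i *\<^sub>R R i + (y * W i - c j *\<^sub>R W i)"
          using W[of i] i by (simp add: K_def algebra_simps)
        then have "E (c j) * (z * R i) = \<mu> i *\<^sub>R (E (c j) * R i) + (E (c j) * y * W i - c j *\<^sub>R (E (c j) * W i))"
          by (simp add: distrib_left right_diff_distrib mult.assoc)
        then show ?thesis
          by (simp add: mult.assoc[symmetric] ER[OF i] spectral_resolution_right[OF res True])
      qed
    qed
  qed
qed

section \<open>Polynomial functions with coefficients in an algebra\<close>

text \<open>\<open>poly_fun n f\<close> means that \<open>f\<close> is a polynomial of degree strictly less than \<open>n\<close>.\<close>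

primrec poly_fun :: "nat \<Rightarrow> (real \<Rightarrow> 'a::real_algebra_1) \<Rightarrow> bool" where
  "poly_fun 0 f \<longleftrightarrow> (\<forall>t. f t = 0)"
| "poly_fun (Suc n) f \<longleftrightarrow> (\<exists>c g. poly_fun n g \<and> (\<forall>t. f t = c + t *\<^sub>R g t))"

lemma poly_fun_cong: "poly_fun n f \<Longrightarrow> (\<And>t. g t = f t) \<Longrightarrow> poly_fun n g"
  by (cases n) auto

lemma poly_fun_zero: "poly_fun n (\<lambda>t. 0)"
proof (induction n)
  case (Suc n)
  then show ?case by (auto intro!: exI[of _ 0] exI[of _ "\<lambda>t. 0"])
qed simp

lemma poly_fun_add: "poly_fun n f \<Longrightarrow> poly_fun n g \<Longrightarrow> poly_fun n (\<lambda>t. f t + g t)"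
proof (induction n arbitrary: f g)
  case (Suc n)
  then obtain c f' d g' where "poly_fun n f'" "\<forall>t. f t = c + t *\<^sub>R f' t"
     "poly_fun n g'" "\<forall>t. g t = d + t *\<^sub>R g' t" by auto
  then show ?case using Suc.IH[of f' g']
    by (auto intro!: exI[of _ "c + d"] exI[of _ "\<lambda>t. f' t + g' t"] simp: algebra_simps)
qed simp

lemma poly_fun_mult_left: "poly_fun n f \<Longrightarrow> poly_fun n (\<lambda>t. x * f t)"
proof (induction n arbitrary: f)
  case (Suc n)
  then obtain c f' where "poly_fun n f'" "\<forall>t. f t = c + t *\<^sub>R f' t" by auto
  then show ?case using Suc.IH[of f']
    by (auto intro!: exI[of _ "x * c"] exI[of _ "\<lambda>t. x * f' t"] simp: algebra_simps)
qed simp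

lemma poly_fun_scaleR: "poly_fun n f \<Longrightarrow> poly_fun n (\<lambda>t. r *\<^sub>R f t)"
  using poly_fun_mult_left[of n f "r *\<^sub>R 1"] by simp

lemma poly_fun_diff: "poly_fun n f \<Longrightarrow> poly_fun n g \<Longrightarrow> poly_fun n (\<lambda>t. f t - g t)"
  using poly_fun_add[of n f "\<lambda>t. (-1) *\<^sub>R g t"] poly_fun_scaleR[of n g "-1"] by simp

lemma poly_fun_sum: "(\<And>i. i \<in> S \<Longrightarrow> poly_fun n (f i)) \<Longrightarrow> poly_fun n (\<lambda>t. \<Sum>i\<in>S. f i t)"
  by (induction S rule: infinite_finite_induct) (auto intro: poly_fun_zero poly_fun_add)

lemma poly_fun_Suc: "poly_fun n f \<Longrightarrow> poly_fun (Suc n) f"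
proof (induction n arbitrary: f)
  case (Suc n)
  then obtain c f' where "poly_fun n f'" "\<forall>t. f t = c + t *\<^sub>R f' t" by auto
  then show ?case using Suc.IH[of f'] by (simp only: poly_fun.simps(2)[of "Suc n"]) blast
qed (auto intro!: exI[of _ 0])

lemma poly_fun_mono: "poly_fun n f \<Longrightarrow> n \<le> m \<Longrightarrow> poly_fun m f"
  using lift_Suc_mono_le[of "\<lambda>n. poly_fun n f" n m] poly_fun_Suc by (auto simp: le_bool_def simp del: poly_fun.simps)

lemma poly_fun_const: "poly_fun (Suc n) (\<lambda>t. c)"
  using poly_fun_zero[of n] by (auto intro!: exI[of _ c] exI[of _ "\<lambda>t. 0"])

lemma poly_fun_times_var: "poly_fun n f \<Longrightarrow> poly_fun (Suc n) (\<lambda>t. t *\<^sub>R f t)"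
  by (auto intro!: exI[of _ 0] exI[of _ f])

lemma poly_fun_monom: "poly_fun (Suc n) (\<lambda>t. t ^ n *\<^sub>R c)"
proof (induction n)
  case 0
  then show ?case using poly_fun_const[of 0 c] by simp
next
  case (Suc n)
  show ?case using poly_fun_times_var[OF Suc] by simp
qed

text \<open>Synthetic division: if \<open>g\<close> has quotient \<open>h\<close> at
  \<open>r\<close>, then \<open>c + t *\<^sub>R g t\<close> has quotient
  \<open>g t + r *\<^sub>R h t\<close>.\<close>

lemma poly_fun_div:
  "poly_fun (Suc n) f \<Longrightarrow> \<exists>g. poly_fun n g \<and> (\<forall>t. f t = f r + (t - r) *\<^sub>R g t)"
proof (induction n arbitrary: f)
  case 0
  then show ?case by (auto intro!: exI[of _ "\<lambda>t. 0"])
next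
  case (Suc n)
  then obtain c g where g: "poly_fun (Suc n) g" "\<And>t. f t = c + t *\<^sub>R g t"
    by (simp only: poly_fun.simps(2)[of "Suc n"]) blast
  obtain h where h: "poly_fun n h" "\<And>t. g t = g r + (t - r) *\<^sub>R h t"
    using Suc.IH[OF g(1)] by blast
  have "poly_fun (Suc n) (\<lambda>t. g t + r *\<^sub>R h t)"
    by (intro poly_fun_add g poly_fun_scaleR poly_fun_Suc h)
  moreover have "f t = f r + (t - r) *\<^sub>R (g t + r *\<^sub>R h t)" for t
    by (simp add: g(2) h(2)[of t] algebra_simps)
  ultimately show ?case by blast
qed

text \<open>Each zero splits off a linear factor and lowers the degree. This carries identities from
  the integers to all real parameters.\<close>

lemma poly_fun_infinite_zeros:
  assumes "poly_fun n f" "infinite {t. f t = 0}"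
  shows "f t = 0"
  using assms
proof (induction n arbitrary: f t)
  case (Suc n)
  then obtain r where r: "f r = 0"
    using not_finite_existsD by blast
  obtain g where g: "poly_fun n g" "\<And>t. f t = (t - r) *\<^sub>R g t"
    using poly_fun_div[OF Suc.prems(1), of r] unfolding r by auto
  have "{t. f t = 0} \<subseteq> insert r {t. g t = 0}"
    by (auto simp: g(2))
  then have "infinite {t. g t = 0}"
    using Suc.prems(2) finite_subset by blast
  then show ?case using Suc.IH[OF g(1)] g(2)[of t] by simp
qed simp

text \<open>Takes the place of a continuity argument when a factor \<open>t - r\<close> is
  cancelled.\<close>

lemma poly_fun_zero_off_point:
  assumes "poly_fun n f" "\<And>t. t \<noteq> r \<Longrightarrow> f t = 0"
  shows "f t = 0"
proof (rule poly_fun_infinite_zeros[OF assms(1)])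
  have "UNIV - {r} \<subseteq> {t. f t = 0}" using assms(2) by auto
  moreover have "infinite (UNIV - {r} :: real set)"
    by (simp add: infinite_UNIV_char_0)
  ultimately show "infinite {t. f t = 0}" using finite_subset by blast
qed

text \<open>Together with \<open>poly_fun_top_zero\<close> this allows comparing the highest
  coefficients of an identity, that is, expanding at infinity.\<close>

lemma poly_fun_top:
  "poly_fun (Suc n) f \<Longrightarrow> \<exists>c g. poly_fun n g \<and> (\<forall>t. f t = t ^ n *\<^sub>R c + g t)"
proof (induction n arbitrary: f)
  case 0
  then show ?case by (auto intro!: exI[of _ "\<lambda>t. 0"])
next
  case (Suc n)
  then obtain d h where h: "poly_fun (Suc n) h" "\<And>t. f t = d + t *\<^sub>R h t"
    by (simp only: poly_fun.simps(2)[of "Suc n"]) blast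
  obtain c g where g: "poly_fun n g" "\<And>t. h t = t ^ n *\<^sub>R c + g t"
    using Suc.IH[OF h(1)] by blast
  have "poly_fun (Suc n) (\<lambda>t. d + t *\<^sub>R g t)"
    using g(1) by auto
  moreover have "f t = t ^ Suc n *\<^sub>R c + (d + t *\<^sub>R g t)" for t
    by (simp add: h g algebra_simps)
  ultimately show ?case by blast
qed

lemma poly_fun_top_zero:
  "poly_fun n f \<Longrightarrow> (\<And>t. t ^ n *\<^sub>R c + f t = 0) \<Longrightarrow> c = 0"
proof (induction n arbitrary: f)
  case (Suc n)
  then obtain d g where g: "poly_fun n g" "\<And>t. f t = d + t *\<^sub>R g t"
    by auto
  have d: "d = 0" using Suc.prems(2)[of 0] g(2)[of 0] by simp
  have p: "poly_fun (Suc n) (\<lambda>t. t ^ n *\<^sub>R c + g t)"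
  proof (rule poly_fun_add)
    show "poly_fun (Suc n) (\<lambda>t. t ^ n *\<^sub>R c)" by (rule poly_fun_monom)
    show "poly_fun (Suc n) g" using g(1) by (rule poly_fun_Suc)
  qed
  have "t ^ n *\<^sub>R c + g t = 0" for t
  proof (rule poly_fun_zero_off_point[OF p, of 0])
    fix t :: real assume "t \<noteq> 0"
    have "t *\<^sub>R (t ^ n *\<^sub>R c + g t) = 0"
      using Suc.prems(2)[of t] by (simp add: g(2) d algebra_simps)
    then show "t ^ n *\<^sub>R c + g t = 0" using \<open>t \<noteq> 0\<close> by simp
  qed
  then show ?case using Suc.IH[OF g(1)] by blast
qed (metis (no_types) add.right_neutral poly_fun.simps(1) power_0 scaleR_one)

section \<open>Products of linear factors with rational roots\<close>

text \<open>These are the denominators of the eigenprojections; the inductive form lets roots be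
  removed one at a time. A rational root \<open>r\<close> makes \<open>b + r *\<^sub>R a\<close> a
  multiple of an integer combination, hence diagonalizable.\<close>

inductive rational_split :: "(real \<Rightarrow> real) \<Rightarrow> bool" where
  const: "k \<noteq> 0 \<Longrightarrow> rational_split (\<lambda>t. k)"
| root: "rational_split d \<Longrightarrow> r \<in> \<rat> \<Longrightarrow> rational_split (\<lambda>t. (t - r) * d t)"

lemma rational_split_mult:
  assumes "rational_split d" "rational_split e"
  shows "rational_split (\<lambda>t. d t * e t)"
  using assms
proof (induction d rule: rational_split.induct)
  case (const k)
  from const(2,1) show ?case
  proof (induction e rule: rational_split.induct)
    case (const l)
    then show ?case by (simp add: rational_split.const)
  next
    case (root d r)
    then show ?case
      using rational_split.root[of "\<lambda>t. k * d t" r] by (simp add: mult.left_commute)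
  qed
next
  case (root d r)
  then show ?case
    using rational_split.root[of "\<lambda>t. d t * e t" r] by (simp add: mult.assoc)
qed

lemma rational_split_prod:
  "finite S \<Longrightarrow> (\<And>i. i \<in> S \<Longrightarrow> rational_split (d i)) \<Longrightarrow> rational_split (\<lambda>t. \<Prod>i\<in>S. d i t)"
proof (induction S rule: finite_induct)
  case empty
  then show ?case using rational_split.const[of 1] by simp
next
  case (insert i S)
  then show ?case using rational_split_mult[of "d i" "\<lambda>t. \<Prod>i\<in>S. d i t"] by simp
qed

text \<open>Meant for the difference of two distinct lines with integer slopes and intercepts: it
  has the rational root \<open>- b / a\<close>, or is a nonzero constant if the lines are
  parallel.\<close>

lemma rational_split_linear:
  assumes "a \<in> \<int>" "b \<in> \<int>" "(a, b) \<noteq> (0, 0)"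
  shows "rational_split (\<lambda>t. b + t * a)"
proof (cases "a = 0")
  case True
  then show ?thesis using assms by (auto intro: rational_split.const)
next
  case False
  have "- b / a \<in> \<rat>" using assms Ints_subset_Rats by (auto intro!: Rats_divide)
  from rational_split.root[OF rational_split.const[OF False] this]
  have "rational_split (\<lambda>t. (t - - b / a) * a)" .
  moreover have "(t - - b / a) * a = b + t * a" for t
    using False by (simp add: field_simps)
  ultimately show ?thesis by simp
qed

lemma poly_fun_rational_split:
  assumes "rational_split d" "poly_fun n f"
  shows "\<exists>m. poly_fun m (\<lambda>t. d t *\<^sub>R f t)"
  using assms
proof (induction d rule: rational_split.induct)
  case (const k)
  then show ?case using poly_fun_scaleR by blast
next
  case (root d r)
  then obtain m where m: "poly_fun m (\<lambda>t. d t *\<^sub>R f t)" by blast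
  have "poly_fun (Suc m) (\<lambda>t. t *\<^sub>R (d t *\<^sub>R f t) - r *\<^sub>R (d t *\<^sub>R f t))"
    by (rule poly_fun_diff[OF poly_fun_times_var[OF m] poly_fun_scaleR[OF poly_fun_Suc[OF m]]])
  then have "poly_fun (Suc m) (\<lambda>t. ((t - r) * d t) *\<^sub>R f t)"
    by (rule poly_fun_cong) (simp add: left_diff_distrib scaleR_diff_left)
  then show ?case by blast
qed

section \<open>Pencils with integer spectrum\<close>

text \<open>\<open>fst j\<close> is a candidate eigenvalue of \<open>a\<close> and
  \<open>snd j\<close> one of \<open>b\<close>, so \<open>line j t\<close> is a candidate for
  \<open>b + t *\<^sub>R a\<close>.\<close>

abbreviation line :: "real \<times> real \<Rightarrow> real \<Rightarrow> real" where
  "line j t \<equiv> snd j + t * fst j"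

lemma poly_fun_pencil:
  assumes "poly_fun n f"
  shows "poly_fun (Suc n) (\<lambda>t. (b + t *\<^sub>R a) * f t - line j t *\<^sub>R f t)"
proof -
  have "poly_fun (Suc n) (\<lambda>t. (b * f t - snd j *\<^sub>R f t) + t *\<^sub>R (a * f t - fst j *\<^sub>R f t))"
    by (intro poly_fun_add poly_fun_times_var poly_fun_Suc poly_fun_diff poly_fun_mult_left
        poly_fun_scaleR assms)
  then show ?thesis
    by (rule poly_fun_cong) (simp add: algebra_simps)
qed

text \<open>Partial fractions with denominators cleared: \<open>d\<close> is a product of differences of the lines.\<close>

lemma pencil_partial_fractions:
  fixes a b :: "'a::real_algebra_1"
  assumes "distinct js" "set js \<subseteq> \<int> \<times> \<int>" "poly_fun n z"
    and "\<And>t. fold (\<lambda>j w. (b + t *\<^sub>R a) * w - line j t *\<^sub>R w) js (z t) = 0"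
  shows "\<exists>d m Q. rational_split d \<and> (\<forall>t. d t *\<^sub>R z t = (\<Sum>j\<in>set js. Q j t)) \<and>
    (\<forall>j\<in>set js. poly_fun m (Q j) \<and> (\<forall>t. (b + t *\<^sub>R a) * Q j t = line j t *\<^sub>R Q j t))"
  using assms
proof (induction js arbitrary: n z)
  case Nil
  then show ?case by (auto intro!: exI[of _ "\<lambda>t. 1"] rational_split.const)
next
  case (Cons i js)
  let ?x = "\<lambda>t. b + t *\<^sub>R a"
  \<comment> \<open>The induction applies the first factor to \<open>z\<close> and decomposes the
    result along the remaining lines.\<close>
  let ?z = "\<lambda>t. ?x t * z t - line i t *\<^sub>R z t"
  have pz: "poly_fun (Suc n) ?z" using Cons.prems(3) by (rule poly_fun_pencil)
  obtain d m Q where d: "rational_split d" and sumQ: "\<And>t. d t *\<^sub>R ?z t = (\<Sum>j\<in>set js. Q j t)"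
    and Q: "\<And>j. j \<in> set js \<Longrightarrow> poly_fun m (Q j)"
      "\<And>j t. j \<in> set js \<Longrightarrow> ?x t * Q j t = line j t *\<^sub>R Q j t"
    using Cons.IH[OF _ _ pz] Cons.prems(1,2,4) by (simp add: subset_iff) blast
  \<comment> \<open>On \<open>Q k\<close> the factor of line \<open>i\<close> acts as
    \<open>line k t - line i t\<close>. Scaling by \<open>e0\<close>, the product of all these
    differences, turns division by one of them into multiplication by \<open>e k\<close>.\<close>
  define e where "e = (\<lambda>j t. \<Prod>k\<in>set js - {j}. line k t - line i t)"
  define e0 where "e0 = (\<lambda>t. \<Prod>k\<in>set js. line k t - line i t)"
  have lin: "rational_split (\<lambda>t. line k t - line i t)" if "k \<in> set js" for k
  proof -
    have "rational_split (\<lambda>t. (snd k - snd i) + t * (fst k - fst i))"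
      using that Cons.prems(1,2) by (intro rational_split_linear) (auto simp: prod_eq_iff)
    then show ?thesis by (simp add: algebra_simps)
  qed
  have e: "rational_split (e j)" for j
    unfolding e_def using lin by (intro rational_split_prod) auto
  have e0: "rational_split e0"
    unfolding e0_def using lin by (intro rational_split_prod) auto
  have e0_eq: "e0 t = (line j t - line i t) * e j t" if "j \<in> set js" for j t
    unfolding e_def e0_def using prod.remove[OF finite_set that] by simp
  \<comment> \<open>The factor of line \<open>i\<close> maps \<open>e k t *\<^sub>R Q k t\<close> to
    \<open>e0 t *\<^sub>R Q k t\<close>. Subtracting these preimages from the rescaled
    \<open>z t\<close> leaves a component \<open>R i\<close> that this factor kills.\<close>
  define R where "R = (\<lambda>j t. if j = i then (e0 t * d t) *\<^sub>R z t - (\<Sum>k\<in>set js. e k t *\<^sub>R Q k t)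
     else e j t *\<^sub>R Q j t)"
  have i: "i \<notin> set js" using Cons.prems(1) by simp
  have sumR: "(e0 t * d t) *\<^sub>R z t = (\<Sum>j\<in>set (i # js). R j t)" for t
  proof -
    have "(\<Sum>j\<in>set js. R j t) = (\<Sum>k\<in>set js. e k t *\<^sub>R Q k t)"
      by (rule sum.cong) (use i in \<open>auto simp: R_def\<close>)
    then show ?thesis using i by (simp add: R_def)
  qed
  have eigR: "?x t * R j t = line j t *\<^sub>R R j t" if j: "j \<in> set (i # js)" for j t
  proof (cases "j = i")
    case False
    then show ?thesis using j Q(2)[of j t] by (simp add: R_def mult.commute)
  next
    case True
    have "?x t * R i t - line i t *\<^sub>R R i t =
        e0 t *\<^sub>R (d t *\<^sub>R ?z t) - (\<Sum>k\<in>set js. e k t *\<^sub>R (?x t * Q k t - line i t *\<^sub>R Q k t))"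
      by (simp add: R_def right_diff_distrib scaleR_diff_right sum_distrib_left scaleR_sum_right
          sum_subtractf mult.commute mult.left_commute)
    also have "(\<Sum>k\<in>set js. e k t *\<^sub>R (?x t * Q k t - line i t *\<^sub>R Q k t)) = (\<Sum>k\<in>set js. e0 t *\<^sub>R Q k t)"
    proof (rule sum.cong)
      fix k assume k: "k \<in> set js"
      have "?x t * Q k t - line i t *\<^sub>R Q k t = (line k t - line i t) *\<^sub>R Q k t"
        by (simp only: Q(2)[OF k] scaleR_diff_left)
      then show "e k t *\<^sub>R (?x t * Q k t - line i t *\<^sub>R Q k t) = e0 t *\<^sub>R Q k t"
        by (simp add: e0_eq[OF k] mult.commute)
    qed simp
    also have "e0 t *\<^sub>R (d t *\<^sub>R ?z t) - (\<Sum>k\<in>set js. e0 t *\<^sub>R Q k t) = 0"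
      by (simp only: sumQ scaleR_sum_right[symmetric] diff_self)
    finally show ?thesis using True by simp
  qed
  have "\<exists>m. poly_fun m (R j)" if j: "j \<in> set (i # js)" for j
  proof -
    have ex: "\<exists>m. poly_fun m (\<lambda>t. e k t *\<^sub>R Q k t)" if "k \<in> set js" for k
      using poly_fun_rational_split[OF e Q(1)[OF that]] .
    show ?thesis
    proof (cases "j = i")
      case False
      then show ?thesis using ex[of j] j by (simp add: R_def)
    next
      case True
      obtain f where f: "\<And>k. k \<in> set js \<Longrightarrow> poly_fun (f k) (\<lambda>t. e k t *\<^sub>R Q k t)"
        using ex by metis
      obtain p where p: "poly_fun p (\<lambda>t. (e0 t * d t) *\<^sub>R z t)"
        using poly_fun_rational_split[OF rational_split_mult[OF e0 d] Cons.prems(3)] by blast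
      define N where "N = max p (Max (insert 0 (f ` set js)))"
      have "poly_fun N (\<lambda>t. (e0 t * d t) *\<^sub>R z t - (\<Sum>k\<in>set js. e k t *\<^sub>R Q k t))"
      proof (intro poly_fun_diff poly_fun_sum)
        show "poly_fun N (\<lambda>t. (e0 t * d t) *\<^sub>R z t)"
          using p by (rule poly_fun_mono) (simp add: N_def)
        show "poly_fun N (\<lambda>t. e k t *\<^sub>R Q k t)" if "k \<in> set js" for k
          using f[OF that] by (rule poly_fun_mono) (use that in \<open>simp add: N_def le_max_iff_disj\<close>)
      qed
      then show ?thesis using True by (auto simp: R_def)
    qed
  qed
  then obtain f where f: "\<And>k. k \<in> set (i # js) \<Longrightarrow> poly_fun (f k) (R k)" by metis
  have "poly_fun (Max (f ` set (i # js))) (R k)" if "k \<in> set (i # js)" for k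
    using f[OF that] by (rule poly_fun_mono) (use that in \<open>intro Max_ge; auto\<close>)
  then show ?case
    using rational_split_mult[OF e0 d] sumR eigR
    by (intro exI[of _ "\<lambda>t. e0 t * d t"] exI[of _ "Max (f ` set (i # js))"] exI[of _ R]) blast
qed

text \<open>At a root \<open>r\<close> of \<open>d\<close> the values \<open>Q j r\<close> sum to
  \<open>0\<close>, and first-order independence for the diagonalizable
  \<open>b + r *\<^sub>R a\<close> makes each of them vanish. So every \<open>Q j\<close> is
  divisible by \<open>t - r\<close>, and the root cancels.\<close>

lemma pencil_remove_roots:
  fixes a b :: "'a::real_algebra_1"
  assumes "rational_split d" and fin: "finite J"
    and diag: "\<And>r. r \<in> \<rat> \<Longrightarrow> \<exists>S E. spectral_resolution S E (b + r *\<^sub>R a)"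
    and "\<And>j. j \<in> J \<Longrightarrow> poly_fun n (Q j)"
    and "\<And>j t. j \<in> J \<Longrightarrow> (b + t *\<^sub>R a) * Q j t = line j t *\<^sub>R Q j t"
    and "\<And>t. (\<Sum>j\<in>J. Q j t) = d t *\<^sub>R 1"
  shows "\<exists>m P. (\<forall>j\<in>J. poly_fun m (P j) \<and> (\<forall>t. (b + t *\<^sub>R a) * P j t = line j t *\<^sub>R P j t)) \<and>
    (\<forall>t. (\<Sum>j\<in>J. P j t) = 1)"
  using assms(1,4-)
proof (induction d arbitrary: n Q rule: rational_split.induct)
  case (const k)
  show ?case
  proof (intro exI[of _ n] exI[of _ "\<lambda>j t. (1/k) *\<^sub>R Q j t"] conjI ballI allI)
    fix j assume j: "j \<in> J"
    show "poly_fun n (\<lambda>t. (1/k) *\<^sub>R Q j t)"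
      using const(2)[OF j] by (rule poly_fun_scaleR)
    show "(b + t *\<^sub>R a) * (1/k) *\<^sub>R Q j t = line j t *\<^sub>R (1/k) *\<^sub>R Q j t" for t
      using const(3)[OF j, of t] by simp
  next
    fix t show "(\<Sum>j\<in>J. (1/k) *\<^sub>R Q j t) = 1"
      using const(1) by (simp add: scaleR_sum_right[symmetric] const(4))
  qed
next
  case (root d r)
  let ?x = "\<lambda>t. b + t *\<^sub>R a"
  have pS: "poly_fun (Suc n) (Q j)" if "j \<in> J" for j
    using root.prems(1)[OF that] by (rule poly_fun_Suc)
  obtain W where W: "\<And>j. j \<in> J \<Longrightarrow> poly_fun n (W j)"
    "\<And>j t. j \<in> J \<Longrightarrow> Q j t = Q j r + (t - r) *\<^sub>R W j t"
    using poly_fun_div[OF pS, of _ r] by metis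
  \<comment> \<open>The eigenvalue equation at \<open>t\<close> minus the one at \<open>r\<close>,
    divided by \<open>t - r\<close>. At \<open>t = r\<close> it is the first-order perturbation
    equation.\<close>
  have taylor: "(a * Q j r - fst j *\<^sub>R Q j r) + (?x t * W j t - line j t *\<^sub>R W j t) = 0"
    if j: "j \<in> J" for j t
  proof (rule poly_fun_zero_off_point[where r = r and n = "Suc n"])
    show "poly_fun (Suc n) (\<lambda>t. (a * Q j r - fst j *\<^sub>R Q j r) + (?x t * W j t - line j t *\<^sub>R W j t))"
      by (intro poly_fun_add poly_fun_const poly_fun_pencil W j)
    fix t assume t: "t \<noteq> r"
    have "(t - r) *\<^sub>R ((a * Q j r - fst j *\<^sub>R Q j r) + (?x t * W j t - line j t *\<^sub>R W j t)) =
       (?x t * (Q j r + (t - r) *\<^sub>R W j t) - line j t *\<^sub>R (Q j r + (t - r) *\<^sub>R W j t)) -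
       (?x r * Q j r - line j r *\<^sub>R Q j r)"
      by (simp add: algebra_simps)
    also have "\<dots> = 0"
      using root.prems(2)[OF j, of t] root.prems(2)[OF j, of r] W(2)[OF j, of t] by simp
    finally show "(a * Q j r - fst j *\<^sub>R Q j r) + (?x t * W j t - line j t *\<^sub>R W j t) = 0"
      using t by simp
  qed
  obtain S E where SE: "spectral_resolution S E (?x r)" using diag root.hyps by blast
  have Q0: "Q j r = 0" if j: "j \<in> J" for j
  proof (rule first_order_independence[where z = a and c = "\<lambda>j. line j r" and \<mu> = fst
        and R = "\<lambda>j. Q j r" and W = "\<lambda>j. - W j r", OF SE fin _ _ _ _ j])
    \<comment> \<open>Distinct lines that meet at \<open>r\<close> have different slopes.\<close>
    show "inj_on (\<lambda>j. (line j r, fst j)) J" by (auto simp: inj_on_def)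
    show "?x r * Q j r = line j r *\<^sub>R Q j r" if "j \<in> J" for j
      using root.prems(2)[OF that] .
    show "a * Q j r - fst j *\<^sub>R Q j r = ?x r * - W j r - line j r *\<^sub>R - W j r" if "j \<in> J" for j
      using taylor[OF that, of r] by (simp add: algebra_simps)
    show "(\<Sum>j\<in>J. Q j r) = 0" using root.prems(3)[of r] by simp
  qed
  show ?case
  proof (rule root.IH[of n W])
    fix j assume j: "j \<in> J"
    show "poly_fun n (W j)" using W(1)[OF j] .
    show "?x t * W j t = line j t *\<^sub>R W j t" for t
      using taylor[OF j, of t] by (simp add: Q0[OF j])
  next
    obtain m where m: "poly_fun m (\<lambda>t. d t *\<^sub>R 1::'a)"
      using poly_fun_rational_split[OF root.hyps(1) poly_fun_const[of 0 1]] by blast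
    have "(\<Sum>j\<in>J. W j t) - d t *\<^sub>R 1 = 0" for t
    proof (rule poly_fun_zero_off_point[where r = r and n = "max n m" and f = "\<lambda>t. (\<Sum>j\<in>J. W j t) - d t *\<^sub>R 1"])
      show "poly_fun (max n m) (\<lambda>t. (\<Sum>j\<in>J. W j t) - d t *\<^sub>R 1)"
        by (intro poly_fun_diff poly_fun_sum poly_fun_mono[OF m] poly_fun_mono[OF W(1)]) auto
      fix t assume t: "t \<noteq> r"
      have "(t - r) *\<^sub>R (\<Sum>j\<in>J. W j t) = (\<Sum>j\<in>J. Q j t)"
        unfolding scaleR_sum_right using W(2)[of _ t] Q0 by (intro sum.cong) auto
      then have "(t - r) *\<^sub>R ((\<Sum>j\<in>J. W j t) - d t *\<^sub>R 1) = 0"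
        by (simp add: root.prems(3) scaleR_diff_right)
      then show "(\<Sum>j\<in>J. W j t) - d t *\<^sub>R 1 = 0" using t by simp
    qed
    then show "(\<Sum>j\<in>J. W j t) = d t *\<^sub>R 1" for t by simp
  qed
qed

text \<open>Perturbation at infinity, with \<open>a\<close> perturbed by \<open>b\<close>. In
  positive degree the top coefficients \<open>R j\<close> sum to \<open>0\<close>, and the two
  highest coefficients of the eigenvalue equation supply the hypotheses of first-order independence.
  So the degree drops until the \<open>P j\<close> are constant.\<close>

lemma pencil_constant:
  fixes a b :: "'a::real_algebra_1"
  assumes fin: "finite J" and res: "spectral_resolution S E a"
    and "\<And>j. j \<in> J \<Longrightarrow> poly_fun (Suc n) (P j)"
    and eig: "\<And>j t. j \<in> J \<Longrightarrow> (b + t *\<^sub>R a) * P j t = line j t *\<^sub>R P j t"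
    and sum1: "\<And>t. (\<Sum>j\<in>J. P j t) = 1"
  shows "\<forall>j\<in>J. poly_fun 1 (P j)"
  using assms(3)
proof (induction n)
  case 0
  then show ?case by simp
next
  case (Suc n)
  obtain R P' where P': "\<And>j. j \<in> J \<Longrightarrow> poly_fun (Suc n) (P' j)"
    "\<And>j t. j \<in> J \<Longrightarrow> P j t = t ^ Suc n *\<^sub>R R j + P' j t"
    using poly_fun_top[OF Suc.prems] by metis
  obtain W P'' where P'': "\<And>j. j \<in> J \<Longrightarrow> poly_fun n (P'' j)"
    "\<And>j t. j \<in> J \<Longrightarrow> P' j t = t ^ n *\<^sub>R W j + P'' j t"
    using poly_fun_top[OF P'(1)] by metis
  have eq: "t ^ Suc (Suc n) *\<^sub>R (a * R j - fst j *\<^sub>R R j) +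
      (t ^ Suc n *\<^sub>R (a * W j - fst j *\<^sub>R W j + (b * R j - snd j *\<^sub>R R j)) +
       (t ^ n *\<^sub>R (b * W j - snd j *\<^sub>R W j) +
       ((b + t *\<^sub>R a) * P'' j t - line j t *\<^sub>R P'' j t))) = 0" if j: "j \<in> J" for j t
    using eig[OF j, of t] by (simp add: P'(2)[OF j] P''(2)[OF j] algebra_simps)
  have low: "poly_fun (Suc n) (\<lambda>t. t ^ n *\<^sub>R (b * W j - snd j *\<^sub>R W j) +
       ((b + t *\<^sub>R a) * P'' j t - line j t *\<^sub>R P'' j t))" if j: "j \<in> J" for j
    by (intro poly_fun_add poly_fun_monom poly_fun_pencil P'' j)
  have R: "a * R j - fst j *\<^sub>R R j = 0" if j: "j \<in> J" for j
    by (rule poly_fun_top_zero[OF poly_fun_add[OF poly_fun_monom poly_fun_Suc[OF low[OF j]]] eq[OF j]])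
  have W: "a * W j - fst j *\<^sub>R W j + (b * R j - snd j *\<^sub>R R j) = 0" if j: "j \<in> J" for j
    by (rule poly_fun_top_zero[OF low[OF j]]) (use eq[OF j] R[OF j] in simp)
  have sumR: "(\<Sum>j\<in>J. R j) = 0"
  proof (rule poly_fun_top_zero)
    show "poly_fun (Suc n) (\<lambda>t. (\<Sum>j\<in>J. P' j t) - 1)"
      by (intro poly_fun_diff poly_fun_sum P' poly_fun_const)
    fix t
    have "(\<Sum>j\<in>J. P j t) = (\<Sum>j\<in>J. t ^ Suc n *\<^sub>R R j + P' j t)"
      using P'(2) by (intro sum.cong) auto
    then show "t ^ Suc n *\<^sub>R (\<Sum>j\<in>J. R j) + ((\<Sum>j\<in>J. P' j t) - 1) = 0"
      using sum1[of t] by (simp add: sum.distrib scaleR_sum_right add_diff_eq)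
  qed
  have R0: "R j = 0" if j: "j \<in> J" for j
  proof (rule first_order_independence[where z = b and c = fst and \<mu> = snd
        and W = "\<lambda>j. - W j", OF res fin _ _ _ sumR j])
    show "inj_on (\<lambda>j. (fst j, snd j)) J" by (auto simp: inj_on_def)
    show "a * R j = fst j *\<^sub>R R j" if "j \<in> J" for j
      using R[OF that] by simp
    show "b * R j - snd j *\<^sub>R R j = a * - W j - fst j *\<^sub>R - W j" if "j \<in> J" for j
      using W[OF that] by (simp add: algebra_simps)
  qed
  show ?case
  proof (rule Suc.IH)
    fix j assume j: "j \<in> J"
    show "poly_fun (Suc n) (P j)"
      using P'(1)[OF j] by (rule poly_fun_cong) (simp add: P'(2)[OF j] R0[OF j])
  qed
qed

section \<open>Commutativity from a lattice of diagonalizable elements\<close>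

lemma spectral_resolution_scaleR:
  assumes "spectral_resolution S E x" "r \<noteq> 0"
  shows "spectral_resolution ((*) r ` S) (\<lambda>m. E (m / r)) (r *\<^sub>R x)"
  using assms by (auto simp: spectral_resolution_def sum.reindex inj_on_def)

text \<open>The fold multiplies by the factors \<open>x - l j\<close> from the left. Hence its value
  at \<open>1\<close> can be tested on the components of a resolution of \<open>1\<close>.\<close>

lemma fold_pencil_mult:
  fixes x :: "'a::real_algebra_1"
  shows "fold (\<lambda>j w. x * w - l j *\<^sub>R w) js (z * w) = fold (\<lambda>j w. x * w - l j *\<^sub>R w) js z * w"
proof (induction js arbitrary: z)
  case (Cons j js)
  have "x * (z * w) - l j *\<^sub>R (z * w) = (x * z - l j *\<^sub>R z) * w"
    by (simp add: algebra_simps)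
  then show ?case using Cons by simp
qed simp

lemma fold_pencil_eigenvector:
  fixes x :: "'a::real_algebra_1"
  assumes "x * w = c *\<^sub>R w"
  shows "fold (\<lambda>j w. x * w - l j *\<^sub>R w) js w = (\<Prod>j\<leftarrow>js. c - l j) *\<^sub>R w"
proof -
  have "fold (\<lambda>j w. x * w - l j *\<^sub>R w) js (r *\<^sub>R w) = (r * (\<Prod>j\<leftarrow>js. c - l j)) *\<^sub>R w" for r
  proof (induction js arbitrary: r)
    case (Cons j js)
    have "x * r *\<^sub>R w - l j *\<^sub>R r *\<^sub>R w = (r * (c - l j)) *\<^sub>R w"
      by (simp add: assms algebra_simps)
    then show ?case using Cons[of "r * (c - l j)"] by (simp add: mult.assoc)
  qed simp
  from this[of 1] show ?thesis by simp
qed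

lemma poly_fun_fold_pencil:
  "poly_fun n z \<Longrightarrow> \<exists>m. poly_fun m (\<lambda>t. fold (\<lambda>j w. (b + t *\<^sub>R a) * w - line j t *\<^sub>R w) js (z t))"
proof (induction js arbitrary: n z)
  case (Cons j js)
  show ?case using Cons.IH[OF poly_fun_pencil[OF Cons.prems, of b a j]] by simp
qed auto

text \<open>A Bauer--Fike bound. It does not depend on \<open>s\<close>, so finitely many lines carry all integer
  eigenvalues of the pencil at integer parameters.\<close>

lemma pencil_eigenvalue_bound:
  fixes a b :: "'a::real_normed_algebra_1"
  assumes "spectral_resolution S E a" "(b + s *\<^sub>R a) * e = c *\<^sub>R e" "e \<noteq> 0"
  shows "\<exists>m\<in>S. \<bar>c - s * m\<bar> \<le> (\<Sum>m\<in>S. norm (E m)) * norm b + 1"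
proof (rule ccontr)
  \<comment> \<open>The summand \<open>1\<close> makes the final estimate
    \<open>C * norm e \<le> (C - 1) * norm e\<close> contradictory.\<close>
  define C where "C = (\<Sum>m\<in>S. norm (E m)) * norm b + 1"
  assume "\<not> ?thesis"
  then have far: "C < \<bar>c - s * m\<bar>" if "m \<in> S" for m
    using that by (auto simp: C_def not_le)
  have one: "(\<Sum>m\<in>S. E m) = 1" using assms(1) by (simp add: spectral_resolution_def)
  have C1: "C \<ge> 1" by (simp add: C_def sum_nonneg)
  have le: "C * norm (E m * e) \<le> norm (E m) * norm b * norm e" if m: "m \<in> S" for m
  proof -
    \<comment> \<open>Compression by \<open>E m\<close> replaces \<open>a\<close> by the scalar
      \<open>m\<close>.\<close>
    have "E m * (b * e) + s *\<^sub>R (E m * a * e) = c *\<^sub>R (E m * e)"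
      using arg_cong[OF assms(2), of "\<lambda>w. E m * w"] by (simp add: algebra_simps)
    then have "(c - s * m) *\<^sub>R (E m * e) = E m * (b * e)"
      by (simp add: spectral_resolution_right[OF assms(1) m] algebra_simps)
    then have "\<bar>c - s * m\<bar> * norm (E m * e) = norm (E m * (b * e))"
      by (metis norm_scaleR)
    also have "\<dots> \<le> norm (E m) * (norm b * norm e)"
      by (meson norm_mult_ineq order_trans mult_left_mono norm_ge_zero)
    finally have "\<bar>c - s * m\<bar> * norm (E m * e) \<le> norm (E m) * norm b * norm e" by (simp add: mult.assoc)
    moreover have "C * norm (E m * e) \<le> \<bar>c - s * m\<bar> * norm (E m * e)"
      using far[OF m] by (intro mult_right_mono) auto
    ultimately show ?thesis by simp
  qed
  have "norm e = norm (\<Sum>m\<in>S. E m * e)"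
    by (simp add: sum_distrib_right[symmetric] one)
  also have "\<dots> \<le> (\<Sum>m\<in>S. norm (E m * e))" by (rule norm_sum)
  finally have "C * norm e \<le> (\<Sum>m\<in>S. C * norm (E m * e))"
    using C1 by (simp add: sum_distrib_left[symmetric])
  also have "\<dots> \<le> (\<Sum>m\<in>S. norm (E m) * norm b * norm e)" by (intro sum_mono le)
  also have "\<dots> = (C - 1) * norm e" by (simp add: C_def sum_distrib_right)
  finally have "norm e \<le> 0" by (simp add: left_diff_distrib)
  then show False using assms(3) by simp
qed

definition integer_diagonal :: "'a::real_algebra_1 \<Rightarrow> bool" where
  "integer_diagonal x \<longleftrightarrow> (\<exists>S E. S \<subseteq> \<int> \<and> spectral_resolution S E x)"

theorem integer_diagonal_lattice_commute:
  fixes a b :: "'a::real_normed_algebra_1"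
  assumes diag: "\<And>k l. integer_diagonal (of_int k *\<^sub>R a + of_int l *\<^sub>R b)"
  shows "a * b = b * a"
proof -
  obtain S E where S: "S \<subseteq> \<int>" and res: "spectral_resolution S E a"
    using diag[of 1 0] by (auto simp: integer_diagonal_def)
  have finS: "finite S" using res by (simp add: spectral_resolution_def)
  define C where "C = (\<Sum>m\<in>S. norm (E m)) * norm b + 1"
  \<comment> \<open>Slopes are taken from the spectrum of \<open>a\<close>, intercepts are the
    integers allowed by the bound \<open>C\<close>.\<close>
  define J :: "(real \<times> real) set" where "J = S \<times> of_int ` {- \<lceil>C\<rceil>..\<lceil>C\<rceil>}"
  have finJ: "finite J" using finS by (simp add: J_def)
  obtain js where js: "set js = J" "distinct js" using finite_distinct_list[OF finJ] by blast
  have sub: "set js \<subseteq> \<int> \<times> \<int>" using S by (auto simp: js J_def)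
  let ?F = "\<lambda>t. fold (\<lambda>j w. (b + t *\<^sub>R a) * w - line j t *\<^sub>R w) js"
  have kill_int: "?F (of_int k) 1 = 0" for k :: int
  proof -
    obtain T P where T: "T \<subseteq> \<int>" and P: "spectral_resolution T P (b + of_int k *\<^sub>R a)"
      using diag[of k 1] by (auto simp: integer_diagonal_def add.commute)
    have eig: "(b + of_int k *\<^sub>R a) * P c = c *\<^sub>R P c" if "c \<in> T" for c
      using P that by (simp add: spectral_resolution_def)
    have zero: "?F (of_int k) (P c) = 0" if c: "c \<in> T" for c
    \<comment> \<open>A component may be \<open>0\<close>; the eigenvalue bound applies only to
      nonzero ones.\<close>
    proof (cases "P c = 0")
      case True
      then show ?thesis using fold_pencil_eigenvector[OF eig[OF c], of "\<lambda>j. line j (of_int k)" js] by simp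
    next
      case False
      obtain m where m: "m \<in> S" "\<bar>c - of_int k * m\<bar> \<le> C"
        using pencil_eigenvalue_bound[OF res eig[OF c] False] by (auto simp: C_def)
      \<comment> \<open>Both terms are integers, so their bounded difference is an intercept in
        \<open>J\<close>.\<close>
      have "c - of_int k * m \<in> \<int>" using T S c m(1) by (intro Ints_diff Ints_mult Ints_of_int) auto
      then obtain i where i: "c - of_int k * m = of_int i" by (auto elim: Ints_cases)
      have "i \<in> {- \<lceil>C\<rceil>..\<lceil>C\<rceil>}" using m(2) unfolding i by auto linarith+
      then have "(m, of_int i) \<in> set js" using m(1) by (auto simp: js J_def)
      moreover have "c - line (m, of_int i) (of_int k) = 0" using i by simp
      ultimately have "(\<Prod>j\<leftarrow>js. c - line j (of_int k)) = 0"
        unfolding prod_list_zero_iff by force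
      then show ?thesis using fold_pencil_eigenvector[OF eig[OF c], of "\<lambda>j. line j (of_int k)" js] by simp
    qed
    have "?F (of_int k) 1 = ?F (of_int k) 1 * (\<Sum>c\<in>T. P c)"
      using P by (simp add: spectral_resolution_def)
    also have "\<dots> = (\<Sum>c\<in>T. ?F (of_int k) (1 * P c))"
      by (simp only: fold_pencil_mult sum_distrib_left)
    also have "\<dots> = 0" using zero by simp
    finally show ?thesis .
  qed
  \<comment> \<open>The product of the factors is polynomial in \<open>t\<close> and vanishes at all
    integers, hence identically.\<close>
  have kill: "?F t 1 = 0" for t
  proof -
    obtain m where m: "poly_fun m (\<lambda>t. ?F t 1)"
      using poly_fun_fold_pencil[OF poly_fun_const[of 0 1]] by blast
    have "infinite (\<int> :: real set)"
      unfolding Ints_def by (simp add: finite_image_iff inj_on_def infinite_UNIV_int)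
    moreover have "\<int> \<subseteq> {t. ?F t 1 = 0}" using kill_int by (auto elim: Ints_cases)
    ultimately have "infinite {t. ?F t 1 = 0}" using finite_subset by blast
    then show ?thesis using poly_fun_infinite_zeros[OF m] by blast
  qed
  obtain d n Q where d: "rational_split d" and sumQ: "\<And>t. d t *\<^sub>R 1 = (\<Sum>j\<in>J. Q j t)"
    and Q: "\<And>j. j \<in> J \<Longrightarrow> poly_fun n (Q j)"
      "\<And>j t. j \<in> J \<Longrightarrow> (b + t *\<^sub>R a) * Q j t = line j t *\<^sub>R Q j t"
    using pencil_partial_fractions[OF js(2) sub poly_fun_const[of 0 1] kill] unfolding js(1) by blast
  have diag_rat: "\<exists>S E. spectral_resolution S E (b + r *\<^sub>R a)" if r: "r \<in> \<rat>" for r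
  proof -
    obtain p q :: int where pq: "q > 0" "r = of_int p / of_int q"
      using r by (elim Rats_cases') blast
    obtain T P where P: "spectral_resolution T P (of_int p *\<^sub>R a + of_int q *\<^sub>R b)"
      using diag[of p q] by (auto simp: integer_diagonal_def)
    \<comment> \<open>At \<open>r = p / q\<close> the pencil is a lattice element divided by
      \<open>q\<close>.\<close>
    have "(1 / of_int q) *\<^sub>R (of_int p *\<^sub>R a + of_int q *\<^sub>R b) = b + r *\<^sub>R a"
      using pq by (simp add: scaleR_add_right)
    then show ?thesis
      using spectral_resolution_scaleR[OF P, of "1 / of_int q"] pq(1) by auto
  qed
  obtain m P where "\<forall>j\<in>J. poly_fun m (P j) \<and> (\<forall>t. (b + t *\<^sub>R a) * P j t = line j t *\<^sub>R P j t)"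
      "\<forall>t. (\<Sum>j\<in>J. P j t) = 1"
    using pencil_remove_roots[OF d finJ diag_rat Q sumQ[symmetric]] by blast
  then have P: "\<And>j. j \<in> J \<Longrightarrow> poly_fun m (P j)"
      "\<And>j t. j \<in> J \<Longrightarrow> (b + t *\<^sub>R a) * P j t = line j t *\<^sub>R P j t"
      "\<And>t. (\<Sum>j\<in>J. P j t) = 1"
    by blast+
  have "\<forall>j\<in>J. poly_fun 1 (P j)"
    using pencil_constant[OF finJ res poly_fun_Suc[OF P(1)] P(2,3)] .
  then have R: "P j t = P j 0" if "j \<in> J" for j t
    using that by fastforce
  have bR: "b * P j 0 = snd j *\<^sub>R P j 0" if "j \<in> J" for j
    using P(2)[OF that, of 0] by simp
  \<comment> \<open>By constancy the same \<open>P j 0\<close> serves at \<open>t = 0\<close> and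
    \<open>t = 1\<close>, which separates \<open>a\<close> from \<open>b\<close>.\<close>
  have aR: "a * P j 0 = fst j *\<^sub>R P j 0" if "j \<in> J" for j
    using P(2)[OF that, of 1] bR[OF that] R[OF that, of 1] by (simp add: algebra_simps)
  have one: "(\<Sum>j\<in>J. P j 0) = 1" using P(3)[of 0] .
  have "(a * b) * (\<Sum>j\<in>J. P j 0) = (b * a) * (\<Sum>j\<in>J. P j 0)"
    unfolding sum_distrib_left by (intro sum.cong refl) (simp add: mult.assoc aR bR mult.commute)
  then show ?thesis by (simp add: one)
qed

section \<open>Exponentials in Banach algebras\<close>

text \<open>The norm bound on \<open>g\<close> yields the derivative of \<open>exp\<close> at
  \<open>0\<close>; the factored form evaluates \<open>exp h\<close> on elements killed by
  \<open>h * h\<close>.\<close>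

lemma exp_second_order:
  fixes h :: "'a::{real_normed_algebra_1,banach}"
  obtains g where "exp h = 1 + h + g * (h * h)" "norm g \<le> exp (norm h)"
proof -
  let ?f = "\<lambda>n. inverse (fact (n + 2)) *\<^sub>R h ^ n"
  let ?e = "\<lambda>n. norm h ^ n /\<^sub>R fact n"
  have le: "norm (?f n) \<le> ?e n" for n
  proof -
    have "inverse (fact (n + 2)) \<le> (inverse (fact n) :: real)"
      by (intro le_imp_inverse_le fact_mono) auto
    then show ?thesis
      by (simp add: norm_power_ineq mult_mono)
  qed
  have sumn: "summable (\<lambda>n. norm (?f n))"
    by (rule summable_comparison_test'[OF summable_exp_generic[of "norm h"], of 0]) (use le in simp)
  have "(\<Sum>n. inverse (fact (n + 2)) *\<^sub>R h ^ (n + 2)) = (\<Sum>n. ?f n * (h * h))"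
    by (simp only: power_add power2_eq_square mult_scaleR_left)
  also have "\<dots> = (\<Sum>n. ?f n) * (h * h)"
    using summable_norm_cancel[OF sumn] by (simp add: suminf_mult2)
  finally have "exp h = 1 + h + (\<Sum>n. ?f n) * (h * h)"
    using exp_first_two_terms[of h] by simp
  moreover have "norm (\<Sum>n. ?f n) \<le> exp (norm h)"
  proof -
    have "norm (\<Sum>n. ?f n) \<le> (\<Sum>n. norm (?f n))" by (rule summable_norm[OF sumn])
    also have "\<dots> \<le> (\<Sum>n. ?e n)"
      by (rule suminf_le[OF le sumn summable_exp_generic])
    finally show ?thesis by (simp add: exp_def)
  qed
  ultimately show ?thesis by (rule that)
qed

lemma exp_commutes:
  fixes x y :: "'a::{real_normed_algebra_1,banach}"
  assumes "x * y = y * x"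
  shows "exp x * y = y * exp x"
  unfolding exp_def
  by (simp add: suminf_mult[symmetric] suminf_mult2 summable_exp_generic power_commuting_commutes[OF assms])

lemma exp_mult_exp_minus:
  fixes x :: "'a::{real_normed_algebra_1,banach}"
  shows "exp (- x) * exp x = 1"
  using exp_minus_inverse[of "- x"] by simp

text \<open>As \<open>c\<close> commutes with \<open>b\<close>, the commutator with \<open>x\<close>
  acts on powers of \<open>b\<close> like a derivative with factor \<open>c\<close>. It therefore
  shifts the exponential series by one index.\<close>

lemma exp_commutator:
  fixes b x :: "'a::{real_normed_algebra_1,banach}"
  defines "c \<equiv> b * x - x * b"
  assumes c: "c * b = b * c"
  shows "exp b * x - x * exp b = c * exp b"
proof -
  have pow: "b ^ Suc n * x - x * b ^ Suc n = real (Suc n) *\<^sub>R (c * b ^ n)" for n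
  proof (induction n)
    case 0
    then show ?case by (simp add: c_def)
  next
    case (Suc n)
    have "b ^ Suc (Suc n) * x - x * b ^ Suc (Suc n) =
        b * (b ^ Suc n * x - x * b ^ Suc n) + c * b ^ Suc n"
      by (simp add: c_def algebra_simps)
    also have "\<dots> = real (Suc n) *\<^sub>R (b * c * b ^ n) + c * b ^ Suc n"
      by (simp only: Suc) (simp add: mult.assoc)
    also have "b * c * b ^ n = c * b ^ Suc n" using c by (simp add: mult.assoc[symmetric])
    finally show ?case
      by (simp only: of_nat_Suc[of "Suc n"] scaleR_left_distrib scaleR_one add.commute)
  qed
  let ?g = "\<lambda>n. (b ^ n /\<^sub>R fact n) * x - x * (b ^ n /\<^sub>R fact n)"
  have lhs: "?g sums (exp b * x - x * exp b)"
    by (intro sums_diff sums_mult sums_mult2 exp_converges)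
  have "?g (Suc n) = c * (b ^ n /\<^sub>R fact n)" for n
  proof -
    have "?g (Suc n) = inverse (fact (Suc n)) *\<^sub>R (b ^ Suc n * x - x * b ^ Suc n)"
      by (simp add: scaleR_diff_right)
    also have "\<dots> = (inverse (fact (Suc n)) * real (Suc n)) *\<^sub>R (c * b ^ n)"
      by (simp only: pow scaleR_scaleR)
    also have "inverse (fact (Suc n)) * real (Suc n) = inverse (fact n)"
      by (simp add: field_simps del: of_nat_Suc)
    finally show ?thesis by simp
  qed
  then have "(\<lambda>n. ?g (Suc n)) sums (c * exp b)"
    by (simp only:) (intro sums_mult exp_converges)
  \<comment> \<open>The term \<open>?g 0\<close> is \<open>0\<close>, so the shift does not change
    the sum.\<close>
  then have "?g sums (c * exp b)"
    by (subst (asm) sums_Suc_iff) simp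
  then show ?thesis using lhs sums_unique2 by blast
qed

lemma exp_int_scaleR_eq_1:
  fixes x :: "'a::{real_normed_algebra_1,banach}"
  assumes "exp x = 1"
  shows "exp (of_int k *\<^sub>R x) = 1"
proof -
  have nat: "exp (real n *\<^sub>R x) = 1" for n
  proof (induction n)
    case (Suc n)
    have "exp (real n *\<^sub>R x + x) = exp (real n *\<^sub>R x) * exp x"
      by (rule exp_add_commuting) simp
    then show ?case using Suc assms by (simp add: algebra_simps)
  qed simp
  show ?thesis
  proof (cases k)
    case (nonneg n)
    then show ?thesis using nat by simp
  next
    case (neg n)
    then have "of_int k *\<^sub>R x = - (real (Suc n) *\<^sub>R x)"
      by (simp only: of_int_minus of_int_of_nat_eq scaleR_minus_left)
    then show ?thesis
      using exp_minus_inverse[of "real (Suc n) *\<^sub>R x"] nat[of "Suc n"] by simp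
  qed
qed

lemma exp_has_derivative_at_0:
  "((exp :: 'a \<Rightarrow> 'a::{real_normed_algebra_1,banach}) has_derivative (\<lambda>h. h)) (at 0)"
  unfolding has_derivative_at
proof (intro conjI)
  have le: "norm (norm (exp (0 + h) - exp 0 - h) / norm h) \<le> exp (norm h) * norm h" for h :: 'a
  proof (cases "h = 0")
    case False
    obtain g where g: "exp h = 1 + h + g * (h * h)" "norm g \<le> exp (norm h)"
      by (rule exp_second_order)
    have "norm (g * (h * h)) \<le> exp (norm h) * (norm h * norm h)"
      by (rule order_trans[OF norm_mult_ineq mult_mono[OF g(2) norm_mult_ineq]]) auto
    moreover have "exp (0 + h) - exp 0 - h = g * (h * h)" by (simp add: g(1))
    ultimately have "norm (exp (0 + h) - exp 0 - h) \<le> exp (norm h) * norm h * norm h"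
      by (simp only: mult.assoc)
    then show ?thesis using False by (simp only: pos_divide_le_eq real_norm_def abs_divide abs_norm_cancel zero_less_norm_iff not_False_eq_True)
  qed simp
  have "isCont (\<lambda>h::'a. exp (norm h) * norm h) 0" by (intro continuous_intros)
  then have lim: "((\<lambda>h::'a. exp (norm h) * norm h) \<longlongrightarrow> 0) (at 0)"
    by (simp add: isCont_def)
  show "(\<lambda>h. norm (exp (0 + h) - exp 0 - h) / norm h) \<midarrow>(0::'a)\<rightarrow> 0"
    by (rule Lim_null_comparison[OF always_eventually lim]) (rule allI, rule le)
qed (rule bounded_linear_ident)

text \<open>Commutation with \<open>f s\<close> gives
  \<open>exp (f t) = exp (f t - f s) * exp (f s)\<close>, which reduces the claim to the derivative
  of \<open>exp\<close> at \<open>0\<close>.\<close>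

lemma exp_has_vector_derivative_commuting:
  fixes f :: "real \<Rightarrow> 'a::{real_normed_algebra_1,banach}"
  assumes f: "(f has_vector_derivative f') (at s within T)" and s: "s \<in> T"
    and comm: "\<And>t. t \<in> T \<Longrightarrow> f t * f s = f s * f t"
  shows "((\<lambda>t. exp (f t)) has_vector_derivative f' * exp (f s)) (at s within T)"
proof -
  have "((\<lambda>t. f t - f s) has_derivative (\<lambda>h. h *\<^sub>R f')) (at s within T)"
    using has_derivative_diff[OF f[unfolded has_vector_derivative_def] has_derivative_const] by simp
  moreover have "(exp has_derivative (\<lambda>h. h)) (at (f s - f s))"
    using exp_has_derivative_at_0 by simp
  ultimately have "((\<lambda>t. exp (f t - f s)) has_derivative (\<lambda>h. h *\<^sub>R f')) (at s within T)"
    by (rule has_derivative_compose)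
  then have "((\<lambda>t. exp (f t - f s) * exp (f s)) has_derivative (\<lambda>h. h *\<^sub>R f' * exp (f s))) (at s within T)"
    by (rule has_derivative_mult_left)
  note D = this
  have "exp (f t) = exp (f t - f s) * exp (f s)" if "t \<in> T" for t
  proof -
    have "(f t - f s) * f s = f s * (f t - f s)" using comm[OF that] by (simp add: algebra_simps)
    from exp_add_commuting[OF this] show ?thesis by simp
  qed
  from has_derivative_transform[OF s this D]
  have "((\<lambda>t. exp (f t)) has_derivative (\<lambda>h. h *\<^sub>R f' * exp (f s))) (at s within T)" .
  then show ?thesis by (simp add: has_vector_derivative_def)
qed

section \<open>Algebras over the complex numbers\<close>

text \<open>A central square root of \<open>- 1\<close> serves as the imaginary unit and turns the
  real algebra into a complex one.\<close>

locale complex_scalars =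
  fixes J :: "'a::{real_normed_algebra_1,banach}"
  assumes J_central: "J * x = x * J" and J_square: "J * J = - 1"
begin

definition cs :: "complex \<Rightarrow> 'a" where
  "cs z = Re z *\<^sub>R 1 + Im z *\<^sub>R J"

lemma cs_add: "cs (z + w) = cs z + cs w"
  by (simp add: cs_def algebra_simps)

lemma cs_diff: "cs (z - w) = cs z - cs w"
  by (simp add: cs_def algebra_simps)

lemma cs_minus: "cs (- z) = - cs z"
  by (simp add: cs_def)

lemma cs_mult: "cs (z * w) = cs z * cs w"
proof -
  have "(y *\<^sub>R J) * (v *\<^sub>R J) = - (y * v) *\<^sub>R 1" for y v :: real
    by (simp add: J_square)
  then show ?thesis by (simp add: cs_def distrib_left distrib_right scaleR_diff_left scaleR_left_distrib algebra_simps)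
qed

lemma cs_of_real: "cs (of_real r) = r *\<^sub>R 1"
  by (simp add: cs_def)

lemma cs_0 [simp]: "cs 0 = 0" and cs_1 [simp]: "cs 1 = 1"
  by (simp_all add: cs_def)

lemma cs_central: "cs z * x = x * cs z"
  by (simp add: cs_def distrib_left distrib_right J_central[of x])

lemma cs_left_commute: "x * (cs z * y) = cs z * (x * y)"
  by (metis cs_central mult.assoc)

lemma cs_cancel: "cs z * x = 0 \<Longrightarrow> z \<noteq> 0 \<Longrightarrow> x = 0"
  by (metis cs_1 cs_mult left_inverse mult.assoc mult_1_left mult_zero_right)

lemma bounded_linear_cs: "bounded_linear cs"
  unfolding cs_def
  by (intro bounded_linear_add bounded_linear_scaleR_const bounded_linear_Re bounded_linear_Im)

lemma exp_cs: "exp (cs z) = cs (exp z)"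
proof -
  have pow: "cs z ^ n = cs (z ^ n)" for n
    by (induction n) (simp_all add: cs_mult)
  have "(\<lambda>n. cs (z ^ n /\<^sub>R fact n)) sums cs (exp z)"
    by (rule bounded_linear.sums[OF bounded_linear_cs exp_converges])
  also have "(\<lambda>n. cs (z ^ n /\<^sub>R fact n)) = (\<lambda>n. cs z ^ n /\<^sub>R fact n)"
    by (simp add: pow linear_cmul[OF bounded_linear.linear[OF bounded_linear_cs]])
  finally show ?thesis
    using exp_converges[of "cs z"] sums_unique2 by blast
qed

text \<open>\<open>shift_prod x zs = 0\<close> says that the monic polynomial with roots
  \<open>zs\<close> annihilates \<open>x\<close>; it is the form in which finite dimension
  enters.\<close>

primrec shift_prod :: "'a \<Rightarrow> complex list \<Rightarrow> 'a" where
  "shift_prod x [] = 1"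
| "shift_prod x (z # zs) = (x - cs z) * shift_prod x zs"

lemma shift_prod_commute:
  assumes "y * x = x * y"
  shows "y * shift_prod x zs = shift_prod x zs * y"
proof (induction zs)
  case (Cons z zs)
  have "y * (x - cs z) = (x - cs z) * y"
    using assms by (simp add: algebra_simps cs_central)
  then show ?case using Cons by (metis mult.assoc shift_prod.simps(2))
qed simp

text \<open>Only the first two terms of the series of \<open>exp (x - cs z)\<close> act on such a
  \<open>w\<close>.\<close>

lemma exp_shift_square_zero:
  assumes "(x - cs z) * ((x - cs z) * w) = 0"
  shows "exp x * w = cs (exp z) * (w + (x - cs z) * w)"
proof -
  let ?n = "x - cs z"
  obtain g where g: "exp ?n = 1 + ?n + g * (?n * ?n)"
    by (rule exp_second_order)
  have "exp ?n * w = w + ?n * w"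
    by (simp only: g distrib_right mult.assoc assms) simp
  moreover have "exp (cs z + ?n) = exp (cs z) * exp ?n"
    by (rule exp_add_commuting) (simp add: cs_central)
  ultimately show ?thesis by (simp add: exp_cs mult.assoc)
qed

text \<open>The eigenvectors for eigenvalues outside \<open>2\<pi>i\<int>\<close> and the nilpotent parts both vanish because
  \<open>exp x\<close> acts trivially.\<close>

lemma exp_eq_1_decomposition:
  assumes x: "exp x = 1" and "shift_prod x zs * y = 0"
  shows "\<exists>S E. finite S \<and> y = (\<Sum>m\<in>S. E m) \<and>
    (\<forall>m\<in>S. x * E m = cs (2 * pi * \<i> * of_int m) * E m)"
  using assms(2)
proof (induction zs arbitrary: y)
  case Nil
  then show ?case by (auto intro!: exI[of _ "{}"])
next
  case (Cons z zs)
  let ?t = "\<lambda>m::int. 2 * pi * \<i> * of_int m"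
  let ?n = "x - cs z"
  have "x * ?n = ?n * x" by (simp add: algebra_simps cs_central)
  then have "?n * shift_prod x zs = shift_prod x zs * ?n"
    by (intro shift_prod_commute) simp
  then have "shift_prod x zs * (?n * y) = 0"
    using Cons.prems by (simp only: mult.assoc[symmetric] shift_prod.simps(2))
  from Cons.IH[OF this] obtain S E where S: "finite S" "?n * y = (\<Sum>m\<in>S. E m)"
    and E: "\<And>m. m \<in> S \<Longrightarrow> x * E m = cs (?t m) * E m"
    by blast
  have nE: "?n * E m = cs (?t m - z) * E m" if "m \<in> S" for m
    using E[OF that] by (simp add: left_diff_distrib cs_diff)
  \<comment> \<open>Where the eigenvalue of \<open>E m\<close> differs from \<open>z\<close>,
    \<open>F m\<close> is a preimage of \<open>E m\<close> under \<open>?n\<close>. Removing these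
    from \<open>y\<close> leaves \<open>w\<close>, which \<open>?n\<close> kills when applied
    twice.\<close>
  define S1 where "S1 = {m \<in> S. ?t m \<noteq> z}"
  define F where "F = (\<lambda>m. cs (1 / (?t m - z)) * E m)"
  define w where "w = y - (\<Sum>m\<in>S1. F m)"
  have S1: "finite S1" "S1 \<subseteq> S" using S(1) by (auto simp: S1_def)
  have xF: "x * F m = cs (?t m) * F m" if "m \<in> S1" for m
    unfolding F_def cs_left_commute[of x] cs_left_commute[of "cs (?t m)"]
    using E[of m] that S1(2) by (simp add: subset_iff)
  have nF: "?n * F m = E m" if "m \<in> S1" for m
  proof -
    have "?n * F m = cs (1 / (?t m - z)) * (cs (?t m - z) * E m)"
      using that S1(2) unfolding F_def cs_left_commute[of ?n] by (subst nE) auto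
    also have "\<dots> = cs (1 / (?t m - z) * (?t m - z)) * E m"
      by (simp only: cs_mult mult.assoc)
    also have "\<dots> = E m" using that by (simp add: S1_def)
    finally show ?thesis .
  qed
  have nw: "?n * w = (\<Sum>m\<in>S - S1. E m)"
  proof -
    have "?n * w = ?n * y - (\<Sum>m\<in>S1. ?n * F m)"
      by (simp add: w_def right_diff_distrib sum_distrib_left)
    also have "\<dots> = (\<Sum>m\<in>S. E m) - (\<Sum>m\<in>S1. E m)"
      using nF by (simp add: S(2))
    also have "\<dots> = (\<Sum>m\<in>S - S1. E m)"
      by (rule sum_diff[OF S(1) S1(2), symmetric])
    finally show ?thesis .
  qed
  have "?n * E m = 0" if "m \<in> S - S1" for m
    using nE[of m] that by (auto simp: S1_def)
  then have nn: "?n * (?n * w) = 0"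
    unfolding nw sum_distrib_left by (intro sum.neutral) blast
  have w: "cs (exp z) * (w + ?n * w) = w"
    using exp_shift_square_zero[OF nn] x by simp
  have y: "y = (\<Sum>m\<in>S1. F m) + w" by (simp add: w_def)
  show ?case
  proof (cases "exp z = 1")
    case True
    then obtain m0 :: int where "Re z = 0" "Im z = of_int (2 * m0) * pi"
      by (auto simp: exp_eq_1)
    then have m0: "z = ?t m0" by (simp add: complex_eq_iff)
    have "?n * w = 0" using w True by simp
    then have xw: "x * w = cs (?t m0) * w" by (simp add: m0 left_diff_distrib)
    have notin: "m0 \<notin> S1" by (simp add: S1_def m0)
    have sum: "(\<Sum>m\<in>S1. (if m = m0 then w else F m)) = (\<Sum>m\<in>S1. F m)"
      by (rule sum.cong) (use notin in auto)
    show ?thesis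
    proof (intro exI[of _ "insert m0 S1"] exI[of _ "\<lambda>m. if m = m0 then w else F m"] conjI ballI)
      show "finite (insert m0 S1)" using S1 by simp
      show "y = (\<Sum>m\<in>insert m0 S1. if m = m0 then w else F m)"
        using S1(1) notin sum y by (simp add: add.commute)
      show "x * (if m = m0 then w else F m) = cs (?t m) * (if m = m0 then w else F m)"
        if "m \<in> insert m0 S1" for m
        using that xF[of m] xw by auto
    qed
  next
    case False
    \<comment> \<open>Multiplying the identity for \<open>w\<close> by \<open>?n\<close> first
      disposes of the nilpotent part, and then \<open>w\<close> itself must vanish.\<close>
    have "cs (exp z) * (?n * w) = ?n * w"
      using arg_cong[OF w, of "\<lambda>v. ?n * v"] nn
      by (simp only: distrib_left cs_left_commute[of ?n] add_0_right mult_zero_right)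
    then have "cs (1 - exp z) * (?n * w) = 0" by (simp add: cs_diff left_diff_distrib)
    then have 0: "?n * w = 0" by (rule cs_cancel) (use False in simp)
    have "cs (exp z) * w = w" using w 0 by simp
    then have "cs (1 - exp z) * w = 0" by (simp add: cs_diff left_diff_distrib)
    then have "w = 0" by (rule cs_cancel) (use False in simp)
    then have "y = (\<Sum>m\<in>S1. F m)" using y by simp
    then show ?thesis using S1(1) xF by blast
  qed
qed

lemma exp_eq_1_integer_diagonal:
  assumes x: "exp x = 1" and zs: "shift_prod x zs = 0"
  shows "integer_diagonal (cs (1 / (2 * pi * \<i>)) * x)"
proof -
  obtain S :: "int set" and E where S: "finite S" "1 = (\<Sum>m\<in>S. E m)"
    and E: "\<And>m. m \<in> S \<Longrightarrow> x * E m = cs (2 * pi * \<i> * of_int m) * E m"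
    using exp_eq_1_decomposition[OF x, of zs 1] zs by auto
  \<comment> \<open>The floor recovers the integer index from a real eigenvalue.\<close>
  have "spectral_resolution (of_int ` S) (\<lambda>r. E \<lfloor>r\<rfloor>) (cs (1 / (2 * pi * \<i>)) * x)"
    unfolding spectral_resolution_def
  proof (intro conjI ballI)
    show "finite (real_of_int ` S)" using S by simp
    show "(\<Sum>m\<in>real_of_int ` S. E \<lfloor>m\<rfloor>) = 1"
      using S(2) by (simp add: sum.reindex inj_on_def)
    fix r assume "r \<in> real_of_int ` S"
    then obtain m where m: "m \<in> S" "r = of_int m" by blast
    have "cs (1 / (2 * pi * \<i>)) * x * E m = cs (1 / (2 * pi * \<i>) * (2 * pi * \<i> * of_int m)) * E m"
      by (simp only: mult.assoc E[OF m(1)] cs_mult)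
    also have "1 / (2 * pi * \<i>) * (2 * pi * \<i> * of_int m) = of_real r"
      by (simp add: m)
    finally show "cs (1 / (2 * pi * \<i>)) * x * E \<lfloor>r\<rfloor> = r *\<^sub>R E \<lfloor>r\<rfloor>"
      by (simp add: m cs_of_real[of "of_int m", simplified])
  qed
  moreover have "real_of_int ` S \<subseteq> \<int>" by auto
  ultimately show ?thesis unfolding integer_diagonal_def by blast
qed

section \<open>Logarithms in the bicommutant\<close>

text \<open>A factor for the root \<open>0\<close> is \<open>x\<close> itself, which the left
  inverse \<open>v\<close> cancels.\<close>

lemma shift_prod_filter_nonzero:
  assumes inv: "v * x = 1" and "shift_prod x zs * y = 0"
  shows "shift_prod x (filter (\<lambda>z. z \<noteq> 0) zs) * y = 0"
  using assms(2)
proof (induction zs arbitrary: y)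
  case (Cons z zs)
  have comm: "shift_prod x us * (x - cs z) = (x - cs z) * shift_prod x us" for us
    by (rule shift_prod_commute[symmetric]) (simp add: algebra_simps cs_central)
  have "shift_prod x zs * ((x - cs z) * y) = 0"
    using Cons.prems comm[of zs] by (simp add: mult.assoc[symmetric])
  from Cons.IH[OF this] have 0: "(x - cs z) * (shift_prod x (filter (\<lambda>z. z \<noteq> 0) zs) * y) = 0"
    by (simp add: mult.assoc[symmetric] comm)
  show ?case
  proof (cases "z = 0")
    case True
    have "v * x * (shift_prod x (filter (\<lambda>z. z \<noteq> 0) zs) * y) = 0"
      using 0 True by (simp add: mult.assoc)
    then show ?thesis using inv True by simp
  next
    case False
    then show ?thesis using 0 by (simp add: mult.assoc)
  qed
qed simp

text \<open>Builds approximate inverses of \<open>1 + s *\<^sub>R (cs k * u - 1)\<close> as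
  polynomials in \<open>u\<close> with coefficients continuous in \<open>s\<close>. Each root adds
  its factor to the error, so the inverse is exact once \<open>shift_prod u zs\<close>
  vanishes.\<close>

lemma segment_inverse_aux:
  assumes nz: "\<And>z s. z \<in> set zs \<Longrightarrow> s \<in> {0..1} \<Longrightarrow> 1 + of_real s * (k * z - 1) \<noteq> 0"
  shows "\<exists>g. continuous_on {0..1} g \<and> (\<forall>s y. y * u = u * y \<longrightarrow> y * g s = g s * y) \<and>
    (\<forall>s\<in>{0..1}. \<exists>c. 1 - (1 + s *\<^sub>R (cs k * u - 1)) * g s = cs c * shift_prod u zs)"
  using nz
proof (induction zs)
  case Nil
  show ?case
    by (rule exI[of _ "\<lambda>s. 0"]) (auto intro!: exI[of _ 1])
next
  case (Cons z zs)
  let ?M = "\<lambda>s::real. 1 + s *\<^sub>R (cs k * u - 1)"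
  let ?q = "\<lambda>s::real. 1 + of_real s * (k * z - 1)"
  have "\<And>z s. z \<in> set zs \<Longrightarrow> s \<in> {0..1} \<Longrightarrow> 1 + of_real s * (k * z - 1) \<noteq> 0"
    using Cons.prems by simp
  from Cons.IH[OF this] obtain g where cont: "continuous_on {0..1} g"
    and comm: "\<And>s y. y * u = u * y \<Longrightarrow> y * g s = g s * y"
    and rem: "\<And>s. s \<in> {0..1} \<Longrightarrow> \<exists>c. 1 - ?M s * g s = cs c * shift_prod u zs"
    by blast
  have nz: "?q s \<noteq> 0" if "s \<in> {0..1}" for s using Cons.prems[of z s] that by simp
  \<comment> \<open>\<open>?q s\<close> is the value of \<open>?M s\<close> at the root
    \<open>z\<close>. The correction multiplies the error by
    \<open>1 - cs (1 / ?q s) * ?M s\<close>, a scalar multiple of \<open>u - cs z\<close>.\<close>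
  define h where "h = (\<lambda>s. g s + cs (1 / ?q s) * (1 - ?M s * g s))"
  have "continuous_on {0..1} h"
    unfolding h_def
    by (intro continuous_intros cont bounded_linear.continuous_on[OF bounded_linear_cs]) (use nz in auto)
  moreover have "y * h s = h s * y" if y: "y * u = u * y" for s y
  proof -
    have g: "y * g s = g s * y" using comm[OF y] .
    have "y * (cs k * u) = cs k * u * y" by (simp add: cs_left_commute[of y] y mult.assoc)
    then have M: "y * ?M s = ?M s * y" by (simp add: distrib_left distrib_right right_diff_distrib left_diff_distrib)
    then have "y * (?M s * g s) = ?M s * g s * y" using g by (metis mult.assoc)
    then have "y * (1 - ?M s * g s) = (1 - ?M s * g s) * y"
      by (simp only: right_diff_distrib[of y] left_diff_distrib[of _ _ y] mult_1_left mult_1_right)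
    then show ?thesis
      unfolding h_def distrib_left[of y] distrib_right[of _ _ y] g cs_left_commute[of y]
      by (simp only: mult.assoc[of "cs _"])
  qed
  moreover have "\<exists>c. 1 - ?M s * h s = cs c * shift_prod u (z # zs)" if s: "s \<in> {0..1}" for s
  proof -
    obtain c where c: "1 - ?M s * g s = cs c * shift_prod u zs" using rem[OF s] by blast
    let ?r = "1 - ?M s * g s"
    have Mq: "?M s = cs (?q s) + cs (of_real s * k) * (u - cs z)"
    proof -
      have "cs (?q s) = 1 + s *\<^sub>R (cs k * cs z) - s *\<^sub>R 1"
        by (simp add: cs_add cs_diff cs_mult cs_of_real right_diff_distrib scaleR_diff_right)
      then show ?thesis
        by (simp add: cs_mult cs_of_real right_diff_distrib scaleR_diff_right)
    qed
    have "1 - ?M s * h s = ?r - cs (1 / ?q s) * (?M s * ?r)"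
      by (simp add: h_def distrib_left cs_left_commute[of "?M s"])
    also have "\<dots> = ?r - (cs (1 / ?q s) * cs (?q s)) * ?r - cs (1 / ?q s) * (cs (of_real s * k) * ((u - cs z) * ?r))"
      by (subst (2) Mq) (simp only: distrib_right distrib_left mult.assoc diff_diff_eq add.assoc)
    also have "cs (1 / ?q s) * cs (?q s) = 1"
      using nz[OF s] by (simp flip: cs_mult)
    also have "(u - cs z) * ?r = cs c * shift_prod u (z # zs)"
      by (simp only: c cs_left_commute[of "u - cs z"] shift_prod.simps)
    also have "?r - 1 * ?r - cs (1 / ?q s) * (cs (of_real s * k) * (cs c * shift_prod u (z # zs))) =
       cs (- (1 / ?q s * (of_real s * k * c))) * shift_prod u (z # zs)"
      using cs_diff[of 0] by (simp only: cs_mult mult.assoc minus_mult_left mult_1_left diff_self diff_0 cs_0)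
    finally show ?thesis by blast
  qed
  ultimately show ?case by blast
qed

text \<open>The logarithm is \<open>\<integral> w (1 + s w)\<^sup>-\<^sup>1 ds\<close> over \<open>[0, 1]\<close> with \<open>w = k u - 1\<close>, corrected by a logarithm
  of the scalar \<open>k\<close>, which is chosen such that no eigenvalue of \<open>k u\<close> is real.\<close>

lemma log_in_bicommutant:
  assumes inv: "v * u = 1" and zs: "shift_prod u zs = 0"
  obtains a where "exp a = u" "\<And>y. y * u = u * y \<Longrightarrow> y * a = a * y"
proof -
  define zs' where "zs' = filter (\<lambda>z. z \<noteq> 0) zs"
  have zs': "shift_prod u zs' = 0"
    using shift_prod_filter_nonzero[OF inv, of zs 1] zs by (simp add: zs'_def)
  \<comment> \<open>\<open>Im (k * z)\<close> equals \<open>Im z + r * Re z\<close>. Avoiding the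
    quotients keeps it nonzero if \<open>Re z\<close> is nonzero; otherwise it is
    \<open>Im z\<close>, nonzero because the root \<open>0\<close> was filtered out.\<close>
  have "finite ((\<lambda>z. - Im z / Re z) ` set zs')" by simp
  then obtain r :: real where r: "r \<notin> (\<lambda>z. - Im z / Re z) ` set zs'"
    using ex_new_if_finite[OF infinite_UNIV_char_0] by blast
  define k where "k = Complex 1 r"
  have k: "k \<noteq> 0" by (simp add: k_def complex_eq_iff)
  have nz: "1 + of_real s * (k * z - 1) \<noteq> 0" if z: "z \<in> set zs'" for z and s :: real
  proof
    assume 0: "1 + of_real s * (k * z - 1) = 0"
    have "Im (k * z) \<noteq> 0"
    proof
      assume "Im (k * z) = 0"
      then have im: "Im z + r * Re z = 0" by (simp add: k_def)
      have "Re z \<noteq> 0"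
      proof
        assume "Re z = 0"
        with im have "z = 0" by (simp add: complex_eq_iff)
        with z show False by (simp add: zs'_def)
      qed
      with im have "r = - Im z / Re z" by (simp add: field_simps)
      with r z show False by blast
    qed
    moreover have "s * Im (k * z) = 0"
      using arg_cong[OF 0, of Im] by simp
    ultimately have "s = 0" by simp
    with 0 show False by simp
  qed
  let ?M = "\<lambda>s::real. 1 + s *\<^sub>R (cs k * u - 1)"
  define w where "w = cs k * u - 1"
  from segment_inverse_aux[of zs' k u, OF nz] obtain g where cont: "continuous_on {0..1} g"
    and gcomm: "\<And>s y. y * u = u * y \<Longrightarrow> y * g s = g s * y"
    and ginv: "\<And>s. s \<in> {0..1} \<Longrightarrow> ?M s * g s = 1"
    unfolding zs' by auto
  have wcomm: "y * w = w * y" if "y * u = u * y" for y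
    using that by (simp add: w_def right_diff_distrib left_diff_distrib cs_left_commute[of y] mult.assoc)
  have uw: "w * u = u * w" by (rule wcomm[symmetric]) simp
  let ?f = "\<lambda>s. w * g s"
  have contf: "continuous_on {0..1} ?f" by (intro continuous_intros cont)
  define a where "a = (\<lambda>s. integral {0..s} ?f)"
  have acomm: "y * a s = a s * y" if y: "y * u = u * y" and s: "s \<in> {0..1}" for y s
  proof -
    have int: "?f integrable_on {0..s}"
      by (rule integrable_continuous_real, rule continuous_on_subset[OF contf]) (use s in auto)
    have "y * ?f t = ?f t * y" for t
      using wcomm[OF y] gcomm[OF y] by (metis mult.assoc)
    then have eq: "(\<lambda>t. y * t) \<circ> ?f = (\<lambda>t. t * y) \<circ> ?f" by (auto simp: o_def)
    have "y * a s = integral {0..s} ((\<lambda>t. y * t) \<circ> ?f)"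
      unfolding a_def by (rule integral_linear[OF int bounded_linear_mult_right, symmetric])
    also have "\<dots> = a s * y"
      unfolding a_def eq by (rule integral_linear[OF int bounded_linear_mult_left])
    finally show ?thesis .
  qed
  \<comment> \<open>The derivative of \<open>a\<close> is \<open>w\<close> times the inverse of
    \<open>?M s\<close>, so the product rule gives \<open>0\<close>. Comparing \<open>s = 0\<close>
    with \<open>s = 1\<close> yields \<open>exp (a 1) = cs k * u\<close>.\<close>
  have "\<exists>c. \<forall>s\<in>{0..1}. exp (- a s) * ?M s = c"
  proof (rule has_derivative_zero_constant)
    fix s :: real assume s: "s \<in> {0..1}"
    have au: "a s * u = u * a s" using acomm[of u s] s by simp
    have da: "((\<lambda>s. - a s) has_vector_derivative - ?f s) (at s within {0..1})"
      unfolding a_def by (intro has_vector_derivative_minus integral_has_vector_derivative contf s)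
    have "((\<lambda>s. exp (- a s)) has_vector_derivative - ?f s * exp (- a s)) (at s within {0..1})"
    proof (rule exp_has_vector_derivative_commuting[OF da s])
      fix t :: real assume "t \<in> {0..1}"
      then show "- a t * - a s = - a s * - a t" using acomm[OF au, of t] by simp
    qed
    moreover have "(?M has_vector_derivative w) (at s within {0..1})"
      unfolding w_def by (auto intro!: derivative_eq_intros)
    ultimately have D: "((\<lambda>s. exp (- a s) * ?M s) has_vector_derivative
        exp (- a s) * w + - ?f s * exp (- a s) * ?M s) (at s within {0..1})"
      by (rule has_vector_derivative_mult)
    have eu: "exp (- a s) * u = u * exp (- a s)"
      by (rule exp_commutes) (simp add: au)
    have Mu: "?M s * u = u * ?M s"
      using uw by (simp add: w_def[symmetric] distrib_left distrib_right)
    have gM: "g s * ?M s = 1" using gcomm[OF Mu] ginv[OF s] by simp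
    have "?f s * exp (- a s) * ?M s = w * exp (- a s) * (g s * ?M s)"
      using gcomm[OF eu, of s] by (metis mult.assoc)
    also have "\<dots> = exp (- a s) * w" using gM wcomm[OF eu] by simp
    finally have "exp (- a s) * w + - ?f s * exp (- a s) * ?M s = 0" by simp
    with D show "((\<lambda>s. exp (- a s) * ?M s) has_derivative (\<lambda>h. 0)) (at s within {0..1})"
      by (simp add: has_vector_derivative_def)
  qed simp
  then obtain c where c: "\<And>s. s \<in> {0..1} \<Longrightarrow> exp (- a s) * ?M s = c" by blast
  have "exp (- a 1) * ?M 1 = exp (- a 0) * ?M 0" using c[of 0] c[of 1] by simp
  then have "exp (- a 1) * (cs k * u) = 1" by (simp add: a_def)
  then have "exp (a 1) * (exp (- a 1) * (cs k * u)) = exp (a 1)" by simp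
  then have ku: "cs k * u = exp (a 1)" by (simp add: mult.assoc[symmetric] exp_minus_inverse)
  define l where "l = a 1 - cs (Ln k)"
  have "exp (a 1 + cs (- Ln k)) = exp (a 1) * exp (cs (- Ln k))"
    by (rule exp_add_commuting) (simp add: cs_central)
  also have "\<dots> = cs (exp (- Ln k)) * (cs k * u)"
    unfolding exp_cs ku by (rule cs_central[symmetric])
  also have "\<dots> = cs (exp (- Ln k) * k) * u" by (simp only: cs_mult mult.assoc)
  also have "exp (- Ln k) * k = 1" using k by (simp add: exp_minus)
  finally have "exp l = u" using cs_diff[of 0 "Ln k"] by (simp add: l_def)
  moreover have "y * l = l * y" if "y * u = u * y" for y
    using acomm[OF that, of 1] by (simp add: l_def right_diff_distrib left_diff_distrib cs_central)
  ultimately show ?thesis by (rule that)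
qed

end

section \<open>Commutators of the exponentials and of their logarithms\<close>

text \<open>In the commutator of \<open>A + B\<close> with \<open>U * V\<close>, the factor
  \<open>U\<close> moves past \<open>A\<close> and \<open>V\<close> past \<open>B\<close>, which
  leaves these two terms.\<close>

lemma commutator_relation:
  fixes A B U V :: "'a::ring_1"
  assumes AU: "A * U = U * A" and BV: "B * V = V * B" and UV: "U * V = V * U"
    and "(A + B) * (U * V) = (U * V) * (A + B)"
  shows "U * (V * A - A * V) + V * (U * B - B * U) = 0"
proof -
  have "A * (U * V) = U * (A * V)" using AU by (metis mult.assoc)
  moreover have "B * (U * V) = V * (B * U)" using BV UV by (metis mult.assoc)
  moreover have "U * V * B = V * (U * B)" using UV by (simp add: mult.assoc[symmetric])
  ultimately show ?thesis using assms(4)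
    by (simp add: distrib_left distrib_right right_diff_distrib mult.assoc algebra_simps)
qed

text \<open>The relation for \<open>A\<close>, \<open>B + B\<close> minus twice \<open>V\<close>
  times the relation for \<open>A\<close>, \<open>B\<close> eliminates the commutator of
  \<open>U\<close> and \<open>B\<close>.\<close>

lemma double_commutator:
  fixes A B U V :: "'a::ring_1"
  assumes inv: "X * U = 1" and AU: "A * U = U * A" and BV: "B * V = V * B" and UV: "U * V = V * U"
    and h1: "(A + B) * (U * V) = (U * V) * (A + B)"
    and h2: "(A + (B + B)) * (U * (V * V)) = (U * (V * V)) * (A + (B + B))"
  shows "(V * A - A * V) * V = V * (V * A - A * V)"
proof -
  let ?c = "V * A - A * V" and ?d = "U * B - B * U"
  have E1: "U * (V * ?c) + V * (V * ?d) = 0"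
    using arg_cong[OF commutator_relation[OF AU BV UV h1], of "\<lambda>x. V * x"] UV
    by (simp only: distrib_left mult.assoc[symmetric] mult_zero_right)
  have "U * (V * V) = (V * V) * U" using UV by (metis mult.assoc)
  moreover have "(B + B) * (V * V) = (V * V) * (B + B)"
    unfolding distrib_left distrib_right using BV by (metis mult.assoc)
  ultimately have "U * ((V * V) * A - A * (V * V)) + (V * V) * (U * (B + B) - (B + B) * U) = 0"
    using commutator_relation[OF AU, of "B + B" "V * V"] h2 by blast
  moreover have "(V * V) * A - A * (V * V) = V * ?c + ?c * V"
    by (simp add: algebra_simps)
  moreover have "U * (B + B) - (B + B) * U = ?d + ?d" by (simp add: algebra_simps)
  ultimately have E2: "U * (V * ?c) + U * (?c * V) + (V * (V * ?d) + V * (V * ?d)) = 0"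
    by (simp only: distrib_left mult.assoc)
  have "U * (?c * V) - U * (V * ?c) =
      (U * (V * ?c) + U * (?c * V) + (V * (V * ?d) + V * (V * ?d))) -
      (U * (V * ?c) + V * (V * ?d)) - (U * (V * ?c) + V * (V * ?d))"
    by (simp only: algebra_simps)
  also have "\<dots> = 0" by (simp only: E1 E2) simp
  finally have "U * (?c * V - V * ?c) = 0" by (simp only: right_diff_distrib)
  then have "X * (U * (?c * V - V * ?c)) = 0" by (simp only: mult_zero_right)
  then have "?c * V - V * ?c = 0" by (simp only: mult.assoc[symmetric] inv mult_1_left)
  then show ?thesis by (simp only: right_minus_eq)
qed

text \<open>The bicommutant property is used twice: the commutator of \<open>exp b\<close> and
  \<open>A\<close> commutes with \<open>b\<close>, so by the Jacobi identity that of
  \<open>b\<close> and \<open>A\<close> commutes with \<open>exp b\<close>, hence with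
  \<open>b\<close>. Then \<open>exp_commutator\<close> applies.\<close>

lemma log_commutator:
  fixes A b :: "'a::{real_normed_algebra_1,banach}"
  assumes bic: "\<And>y. y * exp b = exp b * y \<Longrightarrow> y * b = b * y"
    and c: "(exp b * A - A * exp b) * exp b = exp b * (exp b * A - A * exp b)"
  shows "exp b * A - A * exp b = (b * A - A * b) * exp b"
    and "(b * A - A * b) * exp b = exp b * (b * A - A * b)"
proof -
  let ?V = "exp b"
  have bV: "b * ?V = ?V * b" by (rule exp_times_arg_commute[symmetric])
  have cb: "(?V * A - A * ?V) * b = b * (?V * A - A * ?V)" using bic[OF c] .
  have "(b * A - A * b) * ?V - ?V * (b * A - A * b) = (?V * A - A * ?V) * b - b * (?V * A - A * ?V)"
  proof -
    have "?V * (b * A) = b * (?V * A)" "A * (b * ?V) = A * (?V * b)"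
      using bV by (metis mult.assoc)+
    then show ?thesis by (simp add: algebra_simps)
  qed
  then show V: "(b * A - A * b) * ?V = ?V * (b * A - A * b)" using cb by simp
  show "?V * A - A * ?V = (b * A - A * b) * ?V"
    by (rule exp_commutator) (rule bic[OF V])
qed

section \<open>Commutativity from the homomorphism property\<close>

context complex_scalars
begin

theorem commute_of_exp_hom:
  fixes A B :: 'a
  assumes alg: "\<And>x. \<exists>zs. shift_prod x zs = 0"
    and hom: "\<And>k l. exp (of_int k *\<^sub>R A + of_int l *\<^sub>R B) = exp (of_int k *\<^sub>R A) * exp (of_int l *\<^sub>R B)"
    and UV: "exp A * exp B = exp B * exp A"
  shows "A * B = B * A"
proof -
  let ?U = "exp A" and ?V = "exp B"
  obtain zs where "shift_prod ?U zs = 0" using alg by blast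
  from log_in_bicommutant[OF exp_mult_exp_minus this] obtain a
    where a: "exp a = ?U" and abic: "\<And>y. y * ?U = ?U * y \<Longrightarrow> y * a = a * y" by blast
  obtain zs where "shift_prod ?V zs = 0" using alg by blast
  from log_in_bicommutant[OF exp_mult_exp_minus this] obtain b
    where b: "exp b = ?V" and bbic: "\<And>y. y * ?V = ?V * y \<Longrightarrow> y * b = b * y" by blast
  have AU: "A * ?U = ?U * A" and BV: "B * ?V = ?V * B"
    by (rule exp_times_arg_commute[symmetric])+
  have Aa: "A * a = a * A" using abic[OF AU] .
  have Bb: "B * b = b * B" using bbic[OF BV] .
  \<comment> \<open>As \<open>?U\<close> commutes with \<open>?V\<close>, it commutes with
    \<open>b\<close>; then \<open>b\<close> commutes with \<open>a\<close>.\<close>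
  have "?U * b = b * ?U" using bbic[OF UV] .
  then have ab: "a * b = b * a" using abic[of b] by simp
  have dbl: "exp (2 *\<^sub>R x) = exp x * exp x" for x :: 'a
    using exp_add_commuting[of x x] by (simp add: scaleR_2)
  have comm: "x * exp x = exp x * x" for x :: 'a by (rule exp_times_arg_commute[symmetric])
  have h1: "(A + B) * (?U * ?V) = (?U * ?V) * (A + B)"
    using comm[of "A + B"] hom[of 1 1] by simp
  have h2: "(A + (B + B)) * (?U * (?V * ?V)) = (?U * (?V * ?V)) * (A + (B + B))"
    using comm[of "A + 2 *\<^sub>R B"] hom[of 1 2] by (simp add: dbl) (simp add: scaleR_2)
  have h3: "(B + (A + A)) * (?V * (?U * ?U)) = (?V * (?U * ?U)) * (B + (A + A))"
  proof -
    have "exp (2 *\<^sub>R A + B) = ?V * (?U * ?U)"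
      using hom[of 2 1] UV by (simp add: dbl) (metis mult.assoc)
    then show ?thesis using comm[of "2 *\<^sub>R A + B"] by (simp add: scaleR_2 add.commute)
  qed
  have h1': "(B + A) * (?V * ?U) = (?V * ?U) * (B + A)"
    using h1 by (simp only: UV add.commute)
  have c1: "(?V * A - A * ?V) * ?V = ?V * (?V * A - A * ?V)"
    by (rule double_commutator[OF exp_mult_exp_minus AU BV UV h1 h2])
  have c2: "(?U * B - B * ?U) * ?U = ?U * (?U * B - B * ?U)"
    by (rule double_commutator[OF exp_mult_exp_minus BV AU UV[symmetric] h1' h3])
  define p where "p = b * A - A * b"
  define q where "q = a * B - B * a"
  have p: "?V * A - A * ?V = p * ?V" "p * ?V = ?V * p"
    using log_commutator[of b A] bbic c1 unfolding b p_def by blast+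
  have q: "?U * B - B * ?U = q * ?U" "q * ?U = ?U * q"
    using log_commutator[of a B] abic c2 unfolding a q_def by blast+
  \<comment> \<open>In terms of the logarithms the relation reads
    \<open>?U * ?V * (p + q) = 0\<close>, and the exponentials are invertible.\<close>
  have "?U * (p * ?V) + ?V * (q * ?U) = 0"
    using commutator_relation[OF AU BV UV h1] by (simp only: p(1) q(1))
  then have "?U * (?V * (p + q)) = 0"
    using UV by (simp only: p(2) q(2) distrib_left mult.assoc[symmetric])
  then have "exp (- B) * (exp (- A) * (?U * (?V * (p + q)))) = 0" by simp
  moreover have "exp (- A) * (?U * (?V * (p + q))) = ?V * (p + q)"
    by (simp only: mult.assoc[symmetric] exp_mult_exp_minus mult_1_left)
  moreover have "exp (- B) * (?V * (p + q)) = p + q"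
    by (simp only: mult.assoc[symmetric] exp_mult_exp_minus mult_1_left)
  ultimately have pq: "p + q = 0" by simp
  define A' where "A' = A - a"
  define B' where "B' = B - b"
  have expA': "exp A' = 1"
    using exp_add_commuting[of A "- a"] Aa by (simp add: A'_def a[symmetric] exp_minus_inverse)
  have expB': "exp B' = 1"
    using exp_add_commuting[of B "- b"] Bb by (simp add: B'_def b[symmetric] exp_minus_inverse)
  have lattice: "exp (of_int k *\<^sub>R A' + of_int l *\<^sub>R B') = 1" for k l :: int
  proof -
    let ?k = "of_int k :: real" and ?l = "of_int l :: real"
    have "?k *\<^sub>R A = ?k *\<^sub>R A' + ?k *\<^sub>R a" by (simp add: A'_def scaleR_diff_right)
    moreover have "exp (?k *\<^sub>R A' + ?k *\<^sub>R a) = exp (?k *\<^sub>R A') * exp (?k *\<^sub>R a)"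
      by (rule exp_add_commuting) (simp add: A'_def algebra_simps Aa)
    ultimately have kA: "exp (?k *\<^sub>R A) = exp (?k *\<^sub>R a)"
      by (simp add: exp_int_scaleR_eq_1[OF expA'])
    have "?l *\<^sub>R B = ?l *\<^sub>R B' + ?l *\<^sub>R b" by (simp add: B'_def scaleR_diff_right)
    moreover have "exp (?l *\<^sub>R B' + ?l *\<^sub>R b) = exp (?l *\<^sub>R B') * exp (?l *\<^sub>R b)"
      by (rule exp_add_commuting) (simp add: B'_def algebra_simps Bb)
    ultimately have lB: "exp (?l *\<^sub>R B) = exp (?l *\<^sub>R b)"
      by (simp add: exp_int_scaleR_eq_1[OF expB'])
    let ?x = "?k *\<^sub>R A + ?l *\<^sub>R B" and ?y = "?k *\<^sub>R a + ?l *\<^sub>R b"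
    have "exp ?y = exp (?k *\<^sub>R a) * exp (?l *\<^sub>R b)"
      by (rule exp_add_commuting) (simp add: ab)
    then have xy: "exp ?x = exp ?y" by (simp add: hom kA lB)
    \<comment> \<open>Only the mixed commutators survive, with common coefficient
      \<open>?k * ?l\<close>; this is where \<open>p + q = 0\<close> enters.\<close>
    have "?x * ?y - ?y * ?x = - ((?k * ?l) *\<^sub>R (p + q))"
      by (simp add: p_def q_def algebra_simps Aa Bb)
    then have "?x * ?y = ?y * ?x" by (simp add: pq)
    then have "exp (?x + - ?y) = exp ?x * exp (- ?y)"
      by (intro exp_add_commuting) (simp only: mult_minus_right mult_minus_left)
    then have "exp (?x - ?y) = 1" by (simp only: xy exp_minus_inverse diff_conv_add_uminus)
    moreover have "?x - ?y = ?k *\<^sub>R A' + ?l *\<^sub>R B'"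
      by (simp add: A'_def B'_def algebra_simps)
    ultimately show ?thesis by simp
  qed
  \<comment> \<open>This scalar maps a spectrum in \<open>2 * pi * \<i>\<close> times the integers
    to an integer spectrum.\<close>
  let ?s = "cs (1 / (2 * pi * \<i>))"
  have "integer_diagonal (of_int k *\<^sub>R (?s * A') + of_int l *\<^sub>R (?s * B'))" for k l :: int
  proof -
    obtain zs where "shift_prod (of_int k *\<^sub>R A' + of_int l *\<^sub>R B') zs = 0" using alg by blast
    from exp_eq_1_integer_diagonal[OF lattice this] show ?thesis by (simp add: distrib_left)
  qed
  then have "?s * A' * (?s * B') = ?s * B' * (?s * A')"
    by (rule integer_diagonal_lattice_commute)
  then have "?s * (?s * (A' * B' - B' * A')) = 0"
    by (simp add: mult.assoc cs_left_commute[of A'] cs_left_commute[of B'] right_diff_distrib)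
  then have "?s * (A' * B' - B' * A') = 0" by (rule cs_cancel) simp
  then have "A' * B' - B' * A' = 0" by (rule cs_cancel) simp
  then have AB': "A' * B' = B' * A'" by simp
  \<comment> \<open>Since \<open>a\<close> and \<open>b\<close> commute, passing to
    \<open>A'\<close> and \<open>B'\<close> leaves \<open>p\<close> and \<open>q\<close> unchanged.
    Then \<open>q\<close> commutes with \<open>A'\<close> because \<open>a\<close> and
    \<open>B'\<close> do.\<close>
  have q': "q = a * B' - B' * a" by (simp add: q_def B'_def algebra_simps ab)
  have p': "p = b * A' - A' * b" by (simp add: p_def A'_def algebra_simps ab)
  have A'a: "A' * a = a * A'" by (simp add: A'_def algebra_simps Aa)
  have "A' * (a * B') = a * B' * A'" "A' * (B' * a) = B' * a * A'"
    using A'a AB' by (metis mult.assoc)+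
  then have "A' * q = q * A'" unfolding q' by (simp add: right_diff_distrib left_diff_distrib)
  moreover have "q = - p" using pq by (simp add: eq_neg_iff_add_eq_0 add.commute)
  ultimately have "A' * p = p * A'" by simp
  moreover have "A' * b - b * A' = - p" by (simp add: p')
  ultimately have "(A' * b - b * A') * A' = A' * (A' * b - b * A')" by simp
  \<comment> \<open>The commutator of \<open>exp A'\<close> with \<open>b\<close> vanishes because
    \<open>exp A' = 1\<close>.\<close>
  from exp_commutator[OF this] have "A' * b - b * A' = 0" by (simp add: expA')
  then have p0: "p = 0" using p' by simp
  then have q0: "q = 0" using pq by simp
  have "A * B - B * A = (A' * B' - B' * A') + q - p + (a * b - b * a)"
    unfolding q' p' A'_def B'_def by (simp add: algebra_simps)
  then show ?thesis by (simp add: p0 q0 AB' ab)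
qed

end

section \<open>Evaluation of complex polynomials at algebra elements\<close>

context complex_scalars
begin

definition poly_at :: "'a \<Rightarrow> complex poly \<Rightarrow> 'a" where
  "poly_at x p = fold_coeffs (\<lambda>c y. cs c + x * y) p 0"

lemma poly_at_0 [simp]: "poly_at x 0 = 0"
  by (simp add: poly_at_def)

lemma poly_at_pCons [simp]: "poly_at x (pCons c p) = cs c + x * poly_at x p"
  by (cases "p = 0 \<and> c = 0") (auto simp: poly_at_def)

lemma poly_at_add: "poly_at x (p + q) = poly_at x p + poly_at x q"
proof (induction p arbitrary: q)
  case (pCons c p)
  obtain d q' where "q = pCons d q'" by (cases q)
  then show ?case by (simp add: pCons cs_add distrib_left)
qed simp

lemma poly_at_smult: "poly_at x (smult c p) = cs c * poly_at x p"
  by (induction p) (simp_all add: cs_mult distrib_left cs_left_commute[of x])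

lemma poly_at_monom: "poly_at x (monom c n) = cs c * x ^ n"
  by (induction n) (simp_all add: monom_0 monom_Suc cs_left_commute[of x])

lemma poly_at_sum: "poly_at x (sum p S) = (\<Sum>i\<in>S. poly_at x (p i))"
  by (induction S rule: infinite_finite_induct) (simp_all add: poly_at_add)

text \<open>The fundamental theorem of algebra supplies a root to split off; the degree
  decreases.\<close>

lemma poly_at_factorization:
  "p \<noteq> 0 \<Longrightarrow> \<exists>c zs. c \<noteq> 0 \<and> poly_at x p = cs c * shift_prod x zs"
proof (induction "degree p" arbitrary: p rule: less_induct)
  case less
  show ?case
  proof (cases "degree p = 0")
    case True
    then obtain c where "p = [:c:]" using degree_eq_zeroE by blast
    then show ?thesis using less.prems by (intro exI[of _ c] exI[of _ "[]"]) simp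
  next
    case False
    then obtain z where "poly p z = 0"
      using fundamental_theorem_of_algebra[of p] by (auto simp: constant_degree)
    then have "[:-z, 1:] dvd p" by (simp only: poly_eq_0_iff_dvd)
    then obtain q where q: "p = [:-z, 1:] * q" by (rule dvdE)
    then have "q \<noteq> 0" using less.prems by auto
    moreover from this have "degree q < degree p" unfolding q by (subst degree_mult_eq) auto
    ultimately obtain c zs where c: "c \<noteq> 0" "poly_at x q = cs c * shift_prod x zs"
      using less.hyps by blast
    have p: "p = smult (- z) q + pCons 0 q" by (simp add: q)
    have "poly_at x p = (x - cs z) * poly_at x q"
      unfolding p poly_at_add poly_at_smult poly_at_pCons by (simp add: cs_minus left_diff_distrib)
    also have "\<dots> = cs c * shift_prod x (z # zs)"
      by (simp add: c(2) cs_left_commute[of "x - cs z"])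
    finally show ?thesis using c(1) by blast
  qed
qed

lemma ex_shift_prod_eq_0:
  assumes "p \<noteq> 0" "poly_at x p = 0"
  shows "\<exists>zs. shift_prod x zs = 0"
  using poly_at_factorization[OF assms(1), of x] assms(2) cs_cancel by metis

end

section \<open>Matrices\<close>

text \<open>A copy of the matrix type: on \<open>complex^'n^'n\<close> the product \<open>*\<close> is componentwise, and its norm is
  not submultiplicative with \<open>norm 1 = 1\<close> for the matrix product.\<close>

typedef ('n::finite) sqmat = "UNIV :: (complex^'n^'n) set"
  morphisms mat_of Sqmat by simp

setup_lifting type_definition_sqmat

lemma matrix_mult_scaleR:
  fixes A B :: "complex^'n^'n"
  shows "(r *\<^sub>R A) ** B = r *\<^sub>R (A ** B)" and "A ** (r *\<^sub>R B) = r *\<^sub>R (A ** B)"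
  by (simp_all add: vec_eq_iff matrix_matrix_mult_def scaleR_sum_right)

lemma matrix_mult_add_right_distrib:
  fixes A B C :: "complex^'n^'n"
  shows "(A + B) ** C = A ** C + B ** C"
  by (simp add: vec_eq_iff matrix_matrix_mult_def distrib_right sum.distrib)

instantiation sqmat :: (finite) real_algebra_1
begin

lift_definition zero_sqmat :: "'a sqmat" is 0 .
lift_definition one_sqmat :: "'a sqmat" is "mat 1" .
lift_definition plus_sqmat :: "'a sqmat \<Rightarrow> 'a sqmat \<Rightarrow> 'a sqmat" is "(+)" .
lift_definition minus_sqmat :: "'a sqmat \<Rightarrow> 'a sqmat \<Rightarrow> 'a sqmat" is "(-)" .
lift_definition uminus_sqmat :: "'a sqmat \<Rightarrow> 'a sqmat" is "uminus" .
lift_definition times_sqmat :: "'a sqmat \<Rightarrow> 'a sqmat \<Rightarrow> 'a sqmat" is "(**)" .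
lift_definition scaleR_sqmat :: "real \<Rightarrow> 'a sqmat \<Rightarrow> 'a sqmat" is "scaleR" .

instance
proof
  show "(0::'a sqmat) \<noteq> 1"
    by transfer (simp add: vec_eq_iff mat_def)
qed (transfer; simp add: algebra_simps matrix_mul_assoc matrix_add_ldistrib matrix_mult_add_right_distrib
      matrix_mult_scaleR)+

end

lemma bounded_linear_matrix_vector: "bounded_linear ((*v) (A :: complex^'n^'m))"
  by (rule matrix_vector_mul_bounded_linear)

instantiation sqmat :: (finite) real_normed_algebra_1
begin

lift_definition norm_sqmat :: "'a sqmat \<Rightarrow> real" is "\<lambda>A. onorm ((*v) A)" .
definition dist_sqmat :: "'a sqmat \<Rightarrow> 'a sqmat \<Rightarrow> real" where "dist_sqmat x y = norm (x - y)"
definition sgn_sqmat :: "'a sqmat \<Rightarrow> 'a sqmat" where "sgn_sqmat x = x /\<^sub>R norm x"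
definition uniformity_sqmat :: "('a sqmat \<times> 'a sqmat) filter" where
  "uniformity_sqmat = (INF e\<in>{0<..}. principal {(x, y). dist x y < e})"
definition open_sqmat :: "'a sqmat set \<Rightarrow> bool" where
  "open_sqmat U \<longleftrightarrow> (\<forall>x\<in>U. \<forall>\<^sub>F (x', y) in uniformity. x' = x \<longrightarrow> y \<in> U)"

instance
proof
  fix x y :: "'a sqmat" and r :: real
  show "norm x = 0 \<longleftrightarrow> x = 0"
  proof transfer
    fix A :: "complex^'a^'a"
    show "onorm ((*v) A) = 0 \<longleftrightarrow> A = 0"
      unfolding onorm_eq_0[OF bounded_linear_matrix_vector]
      using matrix_eq[of A 0] by simp
  qed
  show "norm (x + y) \<le> norm x + norm y"
  proof transfer
    fix A B :: "complex^'a^'a"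
    have "(*v) (A + B) = (\<lambda>v. A *v v + B *v v)"
      by (simp add: fun_eq_iff matrix_vector_mult_add_rdistrib)
    then show "onorm ((*v) (A + B)) \<le> onorm ((*v) A) + onorm ((*v) B)"
      by (simp add: onorm_triangle[OF bounded_linear_matrix_vector bounded_linear_matrix_vector])
  qed
  show "norm (r *\<^sub>R x) = \<bar>r\<bar> * norm x"
  proof transfer
    fix r and A :: "complex^'a^'a"
    have "(*v) (r *\<^sub>R A) = (\<lambda>v. r *\<^sub>R (A *v v))"
      by (simp add: fun_eq_iff vec_eq_iff matrix_vector_mult_def scaleR_sum_right)
    then show "onorm ((*v) (r *\<^sub>R A)) = \<bar>r\<bar> * onorm ((*v) A)"
      by (simp add: onorm_scaleR[OF bounded_linear_matrix_vector])
  qed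
  show "norm (x * y) \<le> norm x * norm y"
  proof transfer
    fix A B :: "complex^'a^'a"
    have "(*v) (A ** B) = (*v) A \<circ> (*v) B"
      by (simp add: fun_eq_iff matrix_vector_mul_assoc)
    then show "onorm ((*v) (A ** B)) \<le> onorm ((*v) A) * onorm ((*v) B)"
      by (simp add: onorm_compose[OF bounded_linear_matrix_vector bounded_linear_matrix_vector])
  qed
  show "norm (1 :: 'a sqmat) = 1"
  proof transfer
    have "(*v) (mat 1 :: complex^'a^'a) = (\<lambda>v. v)" by (simp add: fun_eq_iff)
    then show "onorm ((*v) (mat 1 :: complex^'a^'a)) = 1" by (simp only: onorm_id)
  qed
qed (rule dist_sqmat_def sgn_sqmat_def uniformity_sqmat_def open_sqmat_def)+

end

lemma linear_Sqmat: "linear Sqmat"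
  by (rule linearI) (transfer; simp)+

lemma linear_mat_of: "linear mat_of"
  by (rule linearI) (transfer; simp)+

lemma bounded_linear_Sqmat: "bounded_linear Sqmat"
  using linear_Sqmat by (simp add: linear_conv_bounded_linear)

text \<open>An entry is a coordinate of the image of a basis vector. This makes
  \<open>mat_of\<close> bounded, so completeness carries over to the operator norm.\<close>

lemma norm_entry_le: "norm (mat_of x $ i $ j) \<le> norm x"
proof transfer
  fix A :: "complex^'n^'n" and i j
  have "A $ i $ j = (A *v axis j 1) $ i"
    by (simp add: matrix_vector_mult_def axis_def if_distrib cong: if_cong)
  also have "norm \<dots> \<le> norm (A *v axis j 1)" by (rule Finite_Cartesian_Product.norm_nth_le)
  also have "\<dots> \<le> onorm ((*v) A) * norm (axis j (1::complex))"
    by (rule onorm[OF bounded_linear_matrix_vector])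
  finally show "norm (A $ i $ j) \<le> onorm ((*v) A)" by (simp add: norm_eq_sqrt_inner inner_axis_axis)
qed

lemma bounded_linear_mat_of: "bounded_linear (mat_of :: 'n::finite sqmat \<Rightarrow> _)"
proof (rule bounded_linear_intro)
  fix x y :: "'n sqmat" and r :: real
  show "mat_of (x + y) = mat_of x + mat_of y" "mat_of (r *\<^sub>R x) = r *\<^sub>R mat_of x"
    by (transfer; simp)+
  have "norm (mat_of x) \<le> (\<Sum>i\<in>UNIV. norm (mat_of x $ i))"
    unfolding norm_vec_def[of "mat_of x"] by (rule L2_set_le_sum) simp
  also have "\<dots> \<le> (\<Sum>i\<in>UNIV. \<Sum>j\<in>UNIV. norm (mat_of x $ i $ j))"
    by (intro sum_mono) (simp add: norm_vec_def[of "mat_of x $ _"] L2_set_le_sum)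
  also have "\<dots> \<le> (\<Sum>i\<in>(UNIV :: 'n set). \<Sum>j\<in>(UNIV :: 'n set). norm x)"
    by (intro sum_mono norm_entry_le)
  finally show "norm (mat_of x) \<le> norm x * (real CARD('n) * real CARD('n))"
    by (simp add: mult_ac)
qed

instance sqmat :: (finite) banach
proof
  fix X :: "nat \<Rightarrow> 'a sqmat" assume "Cauchy X"
  then have "Cauchy (\<lambda>n. mat_of (X n))"
    by (rule bounded_linear.Cauchy[OF bounded_linear_mat_of])
  then obtain L where "(\<lambda>n. mat_of (X n)) \<longlonglongrightarrow> L"
    using Cauchy_convergent convergent_def by blast
  then have "(\<lambda>n. Sqmat (mat_of (X n))) \<longlonglongrightarrow> Sqmat L"
    by (rule bounded_linear.tendsto[OF bounded_linear_Sqmat])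
  then show "convergent X"
    by (auto simp: mat_of_inverse convergent_def)
qed

lemma mexp_eq: "mexp M = mat_of (exp (Sqmat M))"
proof -
  have pow: "mat_of (Sqmat M ^ n) = matpow M n" for n
    by (induction n) (simp_all add: one_sqmat.rep_eq times_sqmat.rep_eq Sqmat_inverse)
  have "(\<lambda>n. mat_of (Sqmat M ^ n /\<^sub>R fact n)) sums mat_of (exp (Sqmat M))"
    by (rule bounded_linear.sums[OF bounded_linear_mat_of exp_converges])
  then have "(\<lambda>n. (1 / fact n) *\<^sub>R matpow M n) sums mat_of (exp (Sqmat M))"
    by (simp add: scaleR_sqmat.rep_eq pow inverse_eq_divide)
  then show ?thesis by (simp add: mexp_def sums_unique[symmetric])
qed

lemma mat_mult_entry:
  fixes A :: "complex^'n^'n"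
  shows "(mat c ** A) $ i $ j = c * A $ i $ j" and "(A ** mat c) $ i $ j = c * A $ i $ j"
  by (simp_all add: matrix_matrix_mult_def mat_def mult_delta_left mult_delta_right)

interpretation sqmat: complex_scalars "Sqmat (mat \<i>) :: 'n::finite sqmat"
proof
  fix x :: "'n sqmat"
  show "Sqmat (mat \<i>) * x = x * Sqmat (mat \<i>)"
    by transfer (simp add: vec_eq_iff mat_mult_entry)
  show "Sqmat (mat \<i>) * Sqmat (mat \<i>) = (- 1 :: 'n sqmat)"
    by transfer (simp add: vec_eq_iff mat_mult_entry, simp add: mat_def)
qed

text \<open>One more power of \<open>x\<close> than the real dimension \<open>N\<close> forces a
  linear relation, here with real coefficients.\<close>

lemma sqmat_annihilating_poly:
  fixes x :: "'n::finite sqmat"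
  shows "\<exists>p. p \<noteq> 0 \<and> sqmat.poly_at x p = 0"
proof -
  define N where "N = DIM(complex^'n^'n)"
  define f where "f = (\<lambda>i. mat_of (x ^ i))"
  show ?thesis
  \<comment> \<open>Dependence concerns sets, so coinciding powers are treated apart; they give a
    difference of two monomials.\<close>
  proof (cases "inj_on f {..N}")
    case False
    then obtain i j where ij: "i \<noteq> j" "f i = f j" by (auto simp: inj_on_def)
    have "x ^ i = x ^ j" using ij(2) by (simp add: f_def mat_of_inject)
    then have "sqmat.poly_at x (monom 1 i + monom (- 1) j) = 0"
      by (simp add: sqmat.poly_at_add sqmat.poly_at_monom sqmat.cs_minus)
    moreover have "coeff (monom 1 i + monom (- 1) j :: complex poly) i \<noteq> 0"
      using ij(1) by simp
    then have "monom 1 i + monom (- 1) j \<noteq> (0 :: complex poly)" by (metis coeff_0)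
    ultimately show ?thesis by blast
  next
    case True
    then have "card (f ` {..N}) = Suc N" by (simp add: card_image)
    then have "dependent (f ` {..N})"
      by (intro dependent_biggerset) (simp add: N_def)
    then obtain u where u: "\<exists>v\<in>f ` {..N}. u v \<noteq> 0" "(\<Sum>v\<in>f ` {..N}. u v *\<^sub>R v) = 0"
      by (auto simp: dependent_finite)
    define p where "p = (\<Sum>i\<le>N. monom (complex_of_real (u (f i))) i)"
    obtain i where i: "i \<le> N" "u (f i) \<noteq> 0" using u(1) by auto
    have "coeff p i = complex_of_real (u (f i))"
      using i(1) by (simp add: p_def coeff_sum)
    then have "p \<noteq> 0" using i(2) by auto
    moreover have "sqmat.poly_at x p = 0"
    proof -
      have "(\<Sum>i\<le>N. u (f i) *\<^sub>R f i) = 0" using u(2) True by (simp add: sum.reindex)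
      also have "(\<Sum>i\<le>N. u (f i) *\<^sub>R f i) = mat_of (\<Sum>i\<le>N. u (f i) *\<^sub>R x ^ i)"
        by (simp add: f_def linear_sum[OF linear_mat_of] linear_cmul[OF linear_mat_of])
      finally have "(\<Sum>i\<le>N. u (f i) *\<^sub>R x ^ i) = 0"
        by (metis mat_of_inject zero_sqmat.rep_eq)
      then show ?thesis
        by (simp add: p_def sqmat.poly_at_sum sqmat.poly_at_monom sqmat.cs_of_real)
    qed
    ultimately show ?thesis by blast
  qed
qed

theorem theorem2:
  fixes G :: "(complex^'n^'n) set"
  assumes zero: "0 \<in> G"
    and add: "\<And>A B. A \<in> G \<Longrightarrow> B \<in> G \<Longrightarrow> A + B \<in> G"
    and neg: "\<And>A. A \<in> G \<Longrightarrow> - A \<in> G"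
    and hom: "\<And>A B. A \<in> G \<Longrightarrow> B \<in> G \<Longrightarrow> mexp (A + B) = mexp A ** mexp B"
  shows "\<forall>A\<in>G. \<forall>B\<in>G. A ** B = B ** A"
proof (intro ballI)
  fix A B assume A: "A \<in> G" and B: "B \<in> G"
  have nat: "real n *\<^sub>R M \<in> G" if "M \<in> G" for n M
  proof (induction n)
    case (Suc n)
    then show ?case using add[OF that Suc] by (simp add: scaleR_left_distrib)
  qed (simp add: zero)
  have int: "of_int k *\<^sub>R M \<in> G" if "M \<in> G" for k M
  proof (cases k)
    case (nonneg n)
    then show ?thesis using nat[OF that] by simp
  next
    case (neg n)
    then have "of_int k *\<^sub>R M = - (real (Suc n) *\<^sub>R M)"
      by (simp only: of_int_minus of_int_of_nat_eq scaleR_minus_left)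
    then show ?thesis using assms(3) nat[OF that, of "Suc n"] by simp
  qed
  have exp_hom: "exp (Sqmat M + Sqmat N) = exp (Sqmat M) * exp (Sqmat N)" if "M \<in> G" "N \<in> G" for M N
  proof -
    have "mat_of (exp (Sqmat (M + N))) = mat_of (exp (Sqmat M) * exp (Sqmat N))"
      using hom[OF that] by (simp add: mexp_eq times_sqmat.rep_eq)
    then show ?thesis by (simp add: mat_of_inject linear_add[OF linear_Sqmat])
  qed
  have "Sqmat A * Sqmat B = Sqmat B * Sqmat A"
  proof (rule sqmat.commute_of_exp_hom)
    show "\<exists>zs. sqmat.shift_prod x zs = 0" for x :: "'n sqmat"
      using sqmat_annihilating_poly[of x] sqmat.ex_shift_prod_eq_0 by blast
    show "exp (of_int k *\<^sub>R Sqmat A + of_int l *\<^sub>R Sqmat B) =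
        exp (of_int k *\<^sub>R Sqmat A) * exp (of_int l *\<^sub>R Sqmat B)" for k l
      using exp_hom[OF int[OF A] int[OF B], of k l] by (simp add: linear_cmul[OF linear_Sqmat])
    show "exp (Sqmat A) * exp (Sqmat B) = exp (Sqmat B) * exp (Sqmat A)"
      \<comment> \<open>Both products equal the exponential of the same sum.\<close>
      using exp_hom[OF A B] exp_hom[OF B A] by (simp add: add.commute)
  qed
  then show "A ** B = B ** A"
    by (metis Sqmat_inverse UNIV_I times_sqmat.rep_eq)
qed

end
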